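(* Let $k\ge 1$ and $n\ge k$ be integers. The probability that a homogeneous symmetric polynomial $f(x_1,\ldots,x_n)$ of degree $k$ with non-negative real coefficients is Schur positive equals $\prod_{\lambda\vdash k}\frac{1}{k_\lambda}$. Precisely, let $$M_{\text{slice}}=\Big\{\sum_{\lambda\vdash k}a_\lambda m_\lambda(x_1,\ldots,x_n)\ :\ a_\lambda\in\mathbb{R}_{\ge 0}\text{ for all }\lambda\vdash k,\ \sum_{\lambda\vdash k}a_\lambda=1\Big\}$$ and let $$S_{\text{slice}}=\{f\in M_{\text{slice}}\ :\ f\text{ is Schur positive}\}.$$ Then $$\frac{\operatorname{vol}(S_{\text{slice}})}{\operatorname{vol}(M_{\text{slice}})}=\prod_{\lambda\vdash k}\frac{1}{k_\lambda},$$ where $k_\lambda=\sum_{\mu\vdash k}K_{\lambda,\mu}$ is the sum of the Kostka numbers $K_{\lambda,\mu}$ over all partitions $\mu$ of $k$.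
   Context: A partition $\lambda=(\lambda_1\ge\cdots\ge\lambda_t>0)$ is a finite weakly decreasing sequence of positive integers; $\lambda\vdash k$ means $\sum_i\lambda_i=k$. The monomial symmetric polynomial is $m_\lambda(x_1,\ldots,x_n)=\sum_\alpha x_1^{\alpha_1}\cdots x_n^{\alpha_n}$, summed over all distinct sequences $\alpha=(\alpha_1,\ldots,\alpha_n)$ of non-negative integers whose nonzero parts, arranged in weakly decreasing order, give $\lambda$. A semistandard Young tableau of shape $\lambda$ is a filling of the Young diagram of $\lambda$ (left-justified rows of boxes, with $\lambda_i$ boxes in the $i$th row from the top) by positive integers, weakly increasing from left to right along rows and strictly increasing down columns. The Kostka number $K_{\lambda,\mu}$ is the number of semistandard Young tableaux of shape $\lambda$ with exactly $\mu_i$ entries equal to $i$ for each $i$. The Schur polynomial is $s_\lambda(x_1,\ldots,x_n)=\sum_T x^T$, summed over semistandard Young tableaux $T$ of shape $\lambda$ with entries in $\{1,\ldots,n\}$, where the exponent of $x_i$ in the monomial $x^T$ is the number of entries of $T$ equal to $i$. Since $n\ge k$, both $\{m_\lambda\}_{\lambda\vdash k}$ and $\{s_\lambda\}_{\lambda\vdash k}$ are bases of the real vector space of homogeneous symmetric polynomials of degree $k$ in $x_1,\ldots,x_n$. Such a polynomial is Schur positive if all its coefficients in the basis $\{s_\lambda\}_{\lambda\vdash k}$ are non-negative. Let $p(k)$ be the number of partitions of $k$. Volume means $(p(k)-1)$-dimensional Lebesgue measure on the affine hyperplane $\{\sum_{\lambda\vdash k} a_\lambda m_\lambda : \sum_{\lambda\vdash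 k} a_\lambda=1\}$, identified with $\{(a_\lambda)_{\lambda\vdash k}\in\mathbb{R}^{p(k)} : \sum_{\lambda\vdash k} a_\lambda=1\}$. When $k=1$ this hyperplane is a single point and volume is counting measure. The ratio does not depend on the normalization of the measure. *)

theory Defs
  imports "HOL-Analysis.Analysis" "HOL-Library.Poly_Mapping"
begin

section \<open>Partitions and tableaux\<close>

definition partitions :: "nat \<Rightarrow> nat list set" where
  "partitions k = {la. sorted_wrt (\<ge>) la \<and> (\<forall>p\<in>set la. p > 0) \<and> sum_list la = k}"

lemma finite_partitions: "finite (partitions k)"
proof -
  have "length xs \<le> sum_list xs" if "\<forall>p\<in>set xs. p > 0" for xs :: "nat list"
    using that by (induction xs) auto
  moreover have "set xs \<subseteq> {..sum_list xs}" for xs :: "nat list"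
    using member_le_sum_list by auto
  ultimately have "partitions k \<subseteq> {xs. set xs \<subseteq> {..k} \<and> length xs \<le> k}"
    unfolding partitions_def by blast
  then show ?thesis
    by (rule finite_subset) (simp add: finite_lists_length_le)
qed

text \<open>Boxes are pairs (row, column), both counted from 0; the entries of tableaux and the
  indices of variables are counted from 1.\<close>

definition young_diagram :: "nat list \<Rightarrow> (nat \<times> nat) set" where
  "young_diagram la = {(i, j). i < length la \<and> j < la ! i}"

lemma finite_young_diagram: "finite (young_diagram la)"
proof -
  have "young_diagram la = (SIGMA i:{..<length la}. {..<la ! i})"
    by (auto simp: young_diagram_def)
  then show ?thesis by simp
qed

text \<open>Fillings are extensional functions, so that distinct elements of this set are distinct
  tableaux.\<close>

definition ssyt :: "nat list \<Rightarrow> (nat \<times> nat \<Rightarrow> nat) set" where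
  "ssyt la = {T \<in> young_diagram la \<rightarrow>\<^sub>E {1..}.
     (\<forall>i j j'. j < j' \<and> (i, j) \<in> young_diagram la \<and> (i, j') \<in> young_diagram la
        \<longrightarrow> T (i, j) \<le> T (i, j')) \<and>
     (\<forall>i i' j. i < i' \<and> (i, j) \<in> young_diagram la \<and> (i', j) \<in> young_diagram la
        \<longrightarrow> T (i, j) < T (i', j))}"

lift_definition tableau_weight :: "nat list \<Rightarrow> (nat \<times> nat \<Rightarrow> nat) \<Rightarrow> (nat \<Rightarrow>\<^sub>0 nat)"
  is "\<lambda>la T i. card {c \<in> young_diagram la. T c = i}"
proof -
  fix la :: "nat list" and T :: "nat \<times> nat \<Rightarrow> nat"
  have "{i. card {c \<in> young_diagram la. T c = i} \<noteq> 0} \<subseteq> T ` young_diagram la"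
    by (auto simp: card_eq_0_iff)
  then show "finite {i. card {c \<in> young_diagram la. T c = i} \<noteq> 0}"
    using finite_young_diagram finite_subset by blast
qed

definition kostka :: "nat list \<Rightarrow> nat list \<Rightarrow> nat" where
  "kostka la mu = card {T \<in> ssyt la.
     \<forall>i. Poly_Mapping.lookup (tableau_weight la T) (Suc i) = (if i < length mu then mu ! i else 0)}"

definition kostka_sum :: "nat \<Rightarrow> nat list \<Rightarrow> nat" where
  "kostka_sum k la = (\<Sum>mu\<in>partitions k. kostka la mu)"

section \<open>Symmetric polynomials\<close>

text \<open>A polynomial maps exponent vectors to coefficients; those in the variables
  \<open>x\<^sub>1, \<dots>, x\<^sub>n\<close> have all exponent vectors supported on \<open>{1..n}\<close>.\<close>

type_synonym rpoly = "(nat \<Rightarrow>\<^sub>0 nat) \<Rightarrow>\<^sub>0 real"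

definition const_poly :: "real \<Rightarrow> rpoly" where
  "const_poly a = Poly_Mapping.single 0 a"

definition monomial_exponents :: "nat \<Rightarrow> nat list \<Rightarrow> (nat \<Rightarrow>\<^sub>0 nat) set" where
  "monomial_exponents n la = {\<alpha>. Poly_Mapping.keys \<alpha> \<subseteq> {1..n} \<and>
     rev (sort (filter (\<lambda>e. e \<noteq> 0) (map (Poly_Mapping.lookup \<alpha>) [1..<Suc n]))) = la}"

lemma finite_monomial_exponents: "finite (monomial_exponents n la)"
proof -
  have "(i \<in> {1..n} \<longrightarrow> Poly_Mapping.lookup \<alpha> i \<in> insert 0 (set la)) \<and>
      (i \<notin> {1..n} \<longrightarrow> Poly_Mapping.lookup \<alpha> i = 0)"
    if "\<alpha> \<in> monomial_exponents n la" for \<alpha> i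
  proof -
    have "set la = {e \<in> Poly_Mapping.lookup \<alpha> ` {1..n}. e \<noteq> 0}"
    proof -
      have "set la = set (rev (sort (filter (\<lambda>e. e \<noteq> 0)
          (map (Poly_Mapping.lookup \<alpha>) [1..<Suc n]))))"
        using that unfolding monomial_exponents_def by blast
      also have "\<dots> = {e \<in> Poly_Mapping.lookup \<alpha> ` {1..<Suc n}. e \<noteq> 0}"
        by (simp only: set_rev set_sort set_filter set_map set_upt)
      finally show ?thesis
        by (simp only: atLeastLessThanSuc_atLeastAtMost)
    qed
    moreover have "i \<in> {1..n}" if "Poly_Mapping.lookup \<alpha> i \<noteq> 0"
      using that \<open>\<alpha> \<in> _\<close> unfolding monomial_exponents_def in_keys_iff[symmetric] by blast
    ultimately show ?thesis by blast
  qed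
  then have "Poly_Mapping.lookup ` monomial_exponents n la
      \<subseteq> {f. \<forall>i. (i \<in> {1..n} \<longrightarrow> f i \<in> insert 0 (set la)) \<and> (i \<notin> {1..n} \<longrightarrow> f i = 0)}"
    by (intro image_subsetI CollectI allI)
  moreover have "finite \<dots>"
    using finite_set_of_finite_funs[of "{1..n}" "insert 0 (set la)" 0] by simp
  ultimately have "finite (Poly_Mapping.lookup ` monomial_exponents n la)"
    by (rule finite_subset)
  then show ?thesis
    by (rule finite_imageD) (simp add: inj_on_def poly_mapping_eqI)
qed

definition monomial_sym :: "nat \<Rightarrow> nat list \<Rightarrow> rpoly" where
  "monomial_sym n la = (\<Sum>\<alpha>\<in>monomial_exponents n la. Poly_Mapping.single \<alpha> 1)"

definition ssyt_upto :: "nat \<Rightarrow> nat list \<Rightarrow> (nat \<times> nat \<Rightarrow> nat) set" where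
  "ssyt_upto n la = {T \<in> ssyt la. T ` young_diagram la \<subseteq> {1..n}}"

lemma finite_ssyt_upto: "finite (ssyt_upto n la)"
proof -
  have "T \<in> young_diagram la \<rightarrow>\<^sub>E {1..n}" if "T \<in> ssyt_upto n la" for T
    using that unfolding ssyt_upto_def ssyt_def PiE_def Pi_def by blast
  then have "ssyt_upto n la \<subseteq> young_diagram la \<rightarrow>\<^sub>E {1..n}"
    by blast
  then show ?thesis
    by (rule finite_subset) (simp add: finite_PiE finite_young_diagram)
qed

definition schur :: "nat \<Rightarrow> nat list \<Rightarrow> rpoly" where
  "schur n la = (\<Sum>T\<in>ssyt_upto n la. Poly_Mapping.single (tableau_weight la T) 1)"

text \<open>For \<open>n \<ge> k\<close> the Schur polynomials are a basis, so the coefficients \<open>c\<close> are unique.\<close>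

definition schur_positive :: "nat \<Rightarrow> nat \<Rightarrow> rpoly \<Rightarrow> bool" where
  "schur_positive n k f \<longleftrightarrow>
     (\<exists>c. f = (\<Sum>la\<in>partitions k. const_poly (c la) * schur n la) \<and>
          (\<forall>la\<in>partitions k. c la \<ge> 0))"

section \<open>Slices and their volume\<close>

definition monomial_comb :: "nat \<Rightarrow> nat \<Rightarrow> (nat list \<Rightarrow> real) \<Rightarrow> rpoly" where
  "monomial_comb n k a = (\<Sum>la\<in>partitions k. const_poly (a la) * monomial_sym n la)"

definition M_slice :: "nat \<Rightarrow> nat \<Rightarrow> rpoly set" where
  "M_slice n k = {monomial_comb n k a | a.
     (\<forall>la\<in>partitions k. a la \<ge> 0) \<and> (\<Sum>la\<in>partitions k. a la) = 1}"

definition S_slice :: "nat \<Rightarrow> nat \<Rightarrow> rpoly set" where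
  "S_slice n k = {f \<in> M_slice n k. schur_positive n k f}"

text \<open>The hyperplane \<open>\<Sum> a\<^sub>\<lambda> = 1\<close> is parametrised by the coordinates other than the one of the
  one-row partition \<open>(k)\<close>, which is then determined. This affine bijection carries Lebesgue
  measure on \<open>\<real>\<close> to the power \<open>p(k) - 1\<close> to Lebesgue measure on the hyperplane, up to
  the constant factor \<open>1 / sqrt (p(k))\<close>. For \<open>k = 1\<close> no coordinate is left and the empty product
  measure is the unit mass on one point, i.e. counting measure.\<close>

definition chart_index :: "nat \<Rightarrow> nat list set" where
  "chart_index k = partitions k - {[k]}"

definition hyperplane_point :: "nat \<Rightarrow> (nat list \<Rightarrow> real) \<Rightarrow> (nat list \<Rightarrow> real)" where
  "hyperplane_point k b = b([k] := 1 - (\<Sum>la\<in>chart_index k. b la))"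

definition hyperplane_vol :: "nat \<Rightarrow> nat \<Rightarrow> rpoly set \<Rightarrow> real" where
  "hyperplane_vol n k A =
     measure (completion (\<Pi>\<^sub>M la\<in>chart_index k. (lborel :: real measure)))
       {b \<in> chart_index k \<rightarrow>\<^sub>E UNIV. monomial_comb n k (hyperplane_point k b) \<in> A}"

end

theory Submission
  imports Defs "HOL-Library.List_Lexorder" "HOL-Real_Asymp.Real_Asymp"
begin

text \<open>Since \<open>s\<^sub>\<lambda> = \<Sum>\<^sub>\<mu> K\<^sub>\<lambda>\<^sub>\<mu> m\<^sub>\<mu>\<close> with \<open>K\<close> unitriangular, the Schur positive cone is the image of the cone
  of polynomials with non-negative coefficients under a linear map of determinant 1. Integrating
  \<open>exp (- \<Sum> a)\<close> over the cone above a slice gives the volume of the slice times a constant that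
  depends only on the dimension; a linear substitution turns the integral into
  \<open>\<Prod>\<^sub>\<lambda> (\<integral>\<^sub>0\<^sup>\<infinity> exp (- k\<^sub>\<lambda> c) dc) = \<Prod>\<^sub>\<lambda> 1 / k\<^sub>\<lambda>\<close> for the Schur positive cone, and into 1 for the whole
  cone.\<close>

section \<open>Triangular substitutions and volumes of slices of simplicial cones\<close>

text \<open>The map from Schur coefficients to monomial coefficients does not preserve the
  hyperplane of total 1, so its determinant says nothing directly about slices; this is why the cone
  above a slice is integrated against a weight. The weight depends on the total alone, and the
  coordinates of a Schur polynomial in the monomial basis have total k_la, hence the exponents. The
  constant is the Gamma integral with value \<open>(p(k) - 1)!\<close>; it is never evaluated,
  because it cancels against the same constant for the whole cone.

  Unitriangularity refers to a linear order on partitions: a nonzero Kostka number forces dominance,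
  and the lexicographic order on lists refines dominance. With such an order the coordinates can be
  integrated out one at a time. The expansion in monomial symmetric polynomials rests on the fact
  that permuting the content does not change the number of tableaux. The Bender-Knuth involution
  proves this; on Gelfand-Tsetlin patterns it is a mere reflection of the entries of one level, each
  in its own interval.\<close>

abbreviation lborel_PiM :: "'i set \<Rightarrow> ('i \<Rightarrow> real) measure" where
  "lborel_PiM I \<equiv> Pi\<^sub>M I (\<lambda>_. lborel)"

section \<open>Changes of variables in product Lebesgue measure\<close>

lemma nn_integral_lborel_affine:
  fixes f :: "real \<Rightarrow> ennreal"
  assumes [measurable]: "f \<in> borel_measurable borel" and "0 < c"
  shows "(\<integral>\<^sup>+y. f (c * y + t) \<partial>lborel) = ennreal (1 / c) * (\<integral>\<^sup>+y. f y \<partial>lborel)"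
proof -
  have "(\<integral>\<^sup>+y. f y \<partial>lborel) = ennreal c * (\<integral>\<^sup>+y. f (t + c * y) \<partial>lborel)"
    using nn_integral_real_affine[of f c t] assms by simp
  moreover have "ennreal (1 / c) * ennreal c = 1"
    using \<open>0 < c\<close> by (simp flip: ennreal_mult)
  ultimately show ?thesis
    by (simp add: mult.assoc[symmetric] add.commute)
qed

text \<open>Induction that inserts a new least index \<open>b\<close>. As \<open>K b i = 0\<close>
  for \<open>i \<in> A\<close>, only the new coordinate \<open>b\<close> depends on
  \<open>x b\<close>, and with the others fixed it is affine in \<open>x b\<close> with slope
  \<open>K b b\<close>. Substituting in the inner integral removes \<open>b\<close> and leaves the
  statement for \<open>A\<close>.\<close>

lemma nn_integral_PiM_triangular:
  fixes I :: "'i::linorder set" and K :: "'i \<Rightarrow> 'i \<Rightarrow> real"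
  assumes "finite I" "\<And>i. i \<in> I \<Longrightarrow> 0 < K i i"
    and "\<And>i j. i \<in> I \<Longrightarrow> j \<in> I \<Longrightarrow> i < j \<Longrightarrow> K i j = 0"
    and "f \<in> borel_measurable (lborel_PiM I)"
  shows "(\<integral>\<^sup>+x. f (\<lambda>i\<in>I. \<Sum>j\<in>I. K j i * x j) \<partial>lborel_PiM I)
    = (\<Prod>i\<in>I. ennreal (1 / K i i)) * (\<integral>\<^sup>+x. f x \<partial>lborel_PiM I)"
  using assms
proof (induction I arbitrary: f rule: finite_linorder_min_induct)
  case empty
  then show ?case
    by (simp add: PiM_empty nn_integral_count_space_finite)
next
  case (insert b A)
  interpret product_sigma_finite "\<lambda>_::'i. lborel :: real measure" ..
  note [measurable] = insert.prems(3)
  have "b \<notin> A" using insert.hyps by auto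
  define h where "h = (\<lambda>x. \<integral>\<^sup>+y. f (x(b := y)) \<partial>lborel)"
  have [measurable]: "h \<in> borel_measurable (lborel_PiM A)"
    unfolding h_def by measurable
  have T: "(\<lambda>i\<in>insert b A. \<Sum>j\<in>insert b A. K j i * (x(b := y)) j)
      = (\<lambda>i\<in>A. \<Sum>j\<in>A. K j i * x j)(b := K b b * y + (\<Sum>j\<in>A. K j b * x j))" for x y
  proof -
    have "(\<Sum>j\<in>A. K j i * (x(b := y)) j) = (\<Sum>j\<in>A. K j i * x j)" for i
      using \<open>b \<notin> A\<close> by (intro sum.cong) auto
    moreover have "K b i = 0" if "i \<in> A" for i
      using insert.prems(2)[of b i] insert.hyps that by auto
    ultimately show ?thesis
      using \<open>b \<notin> A\<close> insert.hyps(1) by (auto simp: restrict_def fun_eq_iff)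
  qed
  have "(\<integral>\<^sup>+x. f (\<lambda>i\<in>insert b A. \<Sum>j\<in>insert b A. K j i * x j) \<partial>lborel_PiM (insert b A))
      = (\<integral>\<^sup>+x. (\<integral>\<^sup>+y. f ((\<lambda>i\<in>A. \<Sum>j\<in>A. K j i * x j)(b := K b b * y + (\<Sum>j\<in>A. K j b * x j)))
          \<partial>lborel) \<partial>lborel_PiM A)"
    unfolding T[symmetric] using insert.hyps(1) \<open>b \<notin> A\<close>
    by (intro product_nn_integral_insert) measurable
  also have "\<dots> = (\<integral>\<^sup>+x. ennreal (1 / K b b) * h (\<lambda>i\<in>A. \<Sum>j\<in>A. K j i * x j) \<partial>lborel_PiM A)"
  proof (intro nn_integral_cong)
    fix x assume "x \<in> space (lborel_PiM A)"
    have [measurable]: "(\<lambda>y. f ((\<lambda>i\<in>A. \<Sum>j\<in>A. K j i * x j)(b := y))) \<in> borel_measurable borel"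
    proof -
      have "(\<lambda>i\<in>A. \<Sum>j\<in>A. K j i * x j) \<in> space (lborel_PiM A)"
        by (auto simp: space_PiM)
      then have "(\<lambda>y. (\<lambda>i\<in>A. \<Sum>j\<in>A. K j i * x j)(b := y)) \<in> lborel \<rightarrow>\<^sub>M lborel_PiM (insert b A)"
        by measurable
      then have "(\<lambda>y. f ((\<lambda>i\<in>A. \<Sum>j\<in>A. K j i * x j)(b := y))) \<in> borel_measurable lborel"
        by measurable
      then show ?thesis by simp
    qed
    show "(\<integral>\<^sup>+y. f ((\<lambda>i\<in>A. \<Sum>j\<in>A. K j i * x j)(b := K b b * y + (\<Sum>j\<in>A. K j b * x j))) \<partial>lborel)
        = ennreal (1 / K b b) * h (\<lambda>i\<in>A. \<Sum>j\<in>A. K j i * x j)"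
      unfolding h_def using insert.prems(1)[of b]
      by (intro nn_integral_lborel_affine) auto
  qed
  also have "\<dots> = ennreal (1 / K b b) * (\<integral>\<^sup>+x. h (\<lambda>i\<in>A. \<Sum>j\<in>A. K j i * x j) \<partial>lborel_PiM A)"
    by (rule nn_integral_cmult) measurable
  also have "\<dots> = ennreal (1 / K b b) *
      ((\<Prod>i\<in>A. ennreal (1 / K i i)) * (\<integral>\<^sup>+x. h x \<partial>lborel_PiM A))"
    using insert.prems by (subst insert.IH) auto
  also have "(\<integral>\<^sup>+x. h x \<partial>lborel_PiM A) = (\<integral>\<^sup>+x. f x \<partial>lborel_PiM (insert b A))"
    using insert.hyps(1) \<open>b \<notin> A\<close> unfolding h_def
    by (subst product_nn_integral_insert) auto
  finally show ?case
    using insert.hyps(1) \<open>b \<notin> A\<close> by (simp add: mult.assoc)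
qed

text \<open>Back substitution. It makes the coefficients of a point of the cone unique and linear in
  the point, which serves both for measurability of slices and for identifying the cone after
  substitution.\<close>

lemma triangular_left_inverse:
  fixes I :: "'i::linorder set" and K :: "'i \<Rightarrow> 'i \<Rightarrow> real"
  assumes "finite I" "\<And>i. i \<in> I \<Longrightarrow> 0 < K i i"
    and "\<And>i j. i \<in> I \<Longrightarrow> j \<in> I \<Longrightarrow> i < j \<Longrightarrow> K i j = 0"
  shows "\<exists>L. \<forall>i\<in>I. \<forall>c. c i = (\<Sum>j\<in>I. L i j * (\<Sum>l\<in>I. K l j * c l))"
  using assms
proof (induction I rule: finite_linorder_min_induct)
  case empty
  then show ?case by simp
next
  case (insert b A)
  have "b \<notin> A" using insert.hyps by auto
  have "\<exists>L. \<forall>i\<in>A. \<forall>c. c i = (\<Sum>j\<in>A. L i j * (\<Sum>l\<in>A. K l j * c l))"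
    by (rule insert.IH) (simp_all add: insert.prems)
  then obtain L where "\<forall>i\<in>A. \<forall>c. c i = (\<Sum>j\<in>A. L i j * (\<Sum>l\<in>A. K l j * c l))" ..
  then have L: "\<And>i c. i \<in> A \<Longrightarrow> c i = (\<Sum>j\<in>A. L i j * (\<Sum>l\<in>A. K l j * c l))"
    by simp
  \<comment> \<open>The row of \<open>b\<close> solves
    \<open>a b = K b b * c b + (\<Sum>l\<in>A. K l b * c l)\<close> for \<open>c b\<close>, with the
    \<open>c l\<close> already expressed through \<open>L\<close>.\<close>
  define L' where "L' i j = (if i \<in> A then if j \<in> A then L i j else 0
      else if j \<in> A then - (\<Sum>l\<in>A. K l b * L l j) / K b b else 1 / K b b)" for i j
  have Kb: "K b j = 0" if "j \<in> A" for j
    using insert.prems(2)[of b j] insert.hyps that by auto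
  have L'A: "(\<Sum>j\<in>A. L' i j * (\<Sum>l\<in>insert b A. K l j * c l))
      = (\<Sum>j\<in>A. L' i j * (\<Sum>l\<in>A. K l j * c l))" for i c
    using Kb \<open>b \<notin> A\<close> insert.hyps(1) by (intro sum.cong) auto
  have "c i = (\<Sum>j\<in>insert b A. L' i j * (\<Sum>l\<in>insert b A. K l j * c l))"
    if "i \<in> insert b A" for i and c :: "'i \<Rightarrow> real"
  proof (cases "i \<in> A")
    case True
    have "(\<Sum>j\<in>insert b A. L' i j * (\<Sum>l\<in>insert b A. K l j * c l))
        = (\<Sum>j\<in>A. L' i j * (\<Sum>l\<in>A. K l j * c l))"
      unfolding L'A[symmetric] using True \<open>b \<notin> A\<close> insert.hyps(1) by (simp add: L'_def)
    also have "\<dots> = (\<Sum>j\<in>A. L i j * (\<Sum>l\<in>A. K l j * c l))"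
      using True by (intro sum.cong) (auto simp: L'_def)
    finally show ?thesis using L[OF True] by simp
  next
    case False
    then have "i = b" using that by simp
    have "(\<Sum>j\<in>A. L' b j * (\<Sum>l\<in>A. K l j * c l))
        = (\<Sum>j\<in>A. - (\<Sum>l\<in>A. K l b * L l j) / K b b * (\<Sum>l\<in>A. K l j * c l))"
      using \<open>b \<notin> A\<close> by (intro sum.cong) (auto simp: L'_def)
    also have "\<dots> = - (\<Sum>j\<in>A. \<Sum>l\<in>A. K l b * (L l j * (\<Sum>l\<in>A. K l j * c l))) / K b b"
      by (simp add: sum_negf sum_divide_distrib sum_distrib_right mult.assoc)
    also have "(\<Sum>j\<in>A. \<Sum>l\<in>A. K l b * (L l j * (\<Sum>l\<in>A. K l j * c l)))
        = (\<Sum>l\<in>A. K l b * (\<Sum>j\<in>A. L l j * (\<Sum>l\<in>A. K l j * c l)))"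
      by (subst sum.swap) (simp add: sum_distrib_left)
    also have "\<dots> = (\<Sum>l\<in>A. K l b * c l)"
      using L by (intro sum.cong) auto
    finally have *: "(\<Sum>j\<in>A. L' b j * (\<Sum>l\<in>A. K l j * c l)) = - (\<Sum>l\<in>A. K l b * c l) / K b b" .
    have "(\<Sum>j\<in>insert b A. L' b j * (\<Sum>l\<in>insert b A. K l j * c l))
        = L' b b * (K b b * c b + (\<Sum>l\<in>A. K l b * c l)) - (\<Sum>l\<in>A. K l b * c l) / K b b"
      using \<open>b \<notin> A\<close> insert.hyps(1) unfolding sum.insert[OF insert.hyps(1) \<open>b \<notin> A\<close>, of "\<lambda>j. L' b j * _ j"] L'A *
      by simp
    also have "\<dots> = c b"
      using \<open>b \<notin> A\<close> insert.prems(1)[of b] by (simp add: L'_def field_simps)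
    finally show ?thesis using \<open>i = b\<close> by simp
  qed
  then show ?case by (intro exI[of _ L'] ballI allI)
qed

text \<open>The coordinate \<open>z\<close> is replaced by the total \<open>t\<close>, a
  translation; the remaining coordinates are then scaled by \<open>t\<close>, which contributes
  \<open>t ^ card I\<close>. The integral over the cone above \<open>E\<close> splits into a Gamma
  integral and the volume of \<open>E\<close> in the chart.\<close>

lemma nn_integral_cone:
  fixes I :: "'i::linorder set"
  assumes "finite I" "z \<notin> I" and E [measurable]: "E \<in> sets (lborel_PiM I)"
  shows "(\<integral>\<^sup>+a. indicator {a. 0 < sum a (insert z I) \<and> (\<lambda>i\<in>I. a i / sum a (insert z I)) \<in> E} a
        * ennreal (exp (- sum a (insert z I))) \<partial>lborel_PiM (insert z I))
    = (\<integral>\<^sup>+t. indicator {0<..} t * ennreal (t ^ card I * exp (- t)) \<partial>lborel)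
        * emeasure (lborel_PiM I) E"
proof -
  interpret product_sigma_finite "\<lambda>_::'i. lborel :: real measure" ..
  interpret I: sigma_finite_measure "lborel_PiM I"
    using sigma_finite[OF \<open>finite I\<close>] .
  interpret pair: pair_sigma_finite "lborel_PiM I" "lborel :: real measure" ..
  define g where "g = (\<lambda>x t. indicator {0<..} t * indicator E (\<lambda>i\<in>I. x i / t) * ennreal (exp (- t)))"
  have g [measurable]: "(\<lambda>(x, t). g x t) \<in> borel_measurable (lborel_PiM I \<Otimes>\<^sub>M lborel)"
    unfolding g_def by measurable
  have gS: "indicator {a. 0 < sum a (insert z I) \<and> (\<lambda>i\<in>I. a i / sum a (insert z I)) \<in> E} a
        * ennreal (exp (- sum a (insert z I))) = g (restrict a I) (sum a (insert z I))" for a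
  proof -
    have "(\<lambda>i\<in>I. restrict a I i / sum a (insert z I)) = (\<lambda>i\<in>I. a i / sum a (insert z I))"
      by (auto simp: fun_eq_iff)
    then show ?thesis by (auto simp: g_def split: split_indicator)
  qed
  have "(\<integral>\<^sup>+a. g (restrict a I) (sum a (insert z I)) \<partial>lborel_PiM (insert z I))
      = (\<integral>\<^sup>+x. (\<integral>\<^sup>+y. g (restrict (x(z := y)) I) (sum (x(z := y)) (insert z I)) \<partial>lborel) \<partial>lborel_PiM I)"
    using assms(1,2) by (intro product_nn_integral_insert) (auto simp: insert_absorb)
  also have "\<dots> = (\<integral>\<^sup>+x. (\<integral>\<^sup>+t. g x t \<partial>lborel) \<partial>lborel_PiM I)"
  proof (rule nn_integral_cong)
    fix x assume x: "x \<in> space (lborel_PiM I)"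
    \<comment> \<open>The factor \<open>1 *\<close> puts the translation from \<open>y\<close> to
      the total into the form of \<open>nn_integral_lborel_affine\<close>.\<close>
    have eq: "sum (x(z := y)) (insert z I) = 1 * y + sum x I" "restrict (x(z := y)) I = x" for y
    proof -
      have "sum (x(z := y)) I = sum x I"
        using \<open>z \<notin> I\<close> by (intro sum.cong) auto
      then show "sum (x(z := y)) (insert z I) = 1 * y + sum x I"
        using assms by simp
      show "restrict (x(z := y)) I = x"
        using x \<open>z \<notin> I\<close> by (auto simp: space_PiM fun_eq_iff restrict_def PiE_def extensional_def)
    qed
    have "g x \<in> borel_measurable lborel"
      using x by measurable
    then have "(\<integral>\<^sup>+y. g x (1 * y + sum x I) \<partial>lborel) = ennreal (1 / 1) * (\<integral>\<^sup>+y. g x y \<partial>lborel)"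
      by (intro nn_integral_lborel_affine) auto
    then show "(\<integral>\<^sup>+y. g (restrict (x(z := y)) I) (sum (x(z := y)) (insert z I)) \<partial>lborel)
        = (\<integral>\<^sup>+t. g x t \<partial>lborel)"
      unfolding eq by simp
  qed
  also have "\<dots> = (\<integral>\<^sup>+t. (\<integral>\<^sup>+x. g x t \<partial>lborel_PiM I) \<partial>lborel)"
    using pair.Fubini'[OF g] by simp
  also have "\<dots> = (\<integral>\<^sup>+t. indicator {0<..} t * ennreal (t ^ card I * exp (- t))
      * emeasure (lborel_PiM I) E \<partial>lborel)"
  proof (rule nn_integral_cong)
    fix t :: real
    show "(\<integral>\<^sup>+x. g x t \<partial>lborel_PiM I)
        = indicator {0<..} t * ennreal (t ^ card I * exp (- t)) * emeasure (lborel_PiM I) E"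
    proof (cases "0 < t")
      case True
      \<comment> \<open>Scaling is the diagonal case of a triangular map: each of the
        \<open>card I\<close> diagonal entries \<open>1 / t\<close> contributes a factor
        \<open>t\<close>.\<close>
      have eq: "(\<lambda>i\<in>I. x i / t) = (\<lambda>i\<in>I. \<Sum>j\<in>I. (if j = i then 1 / t else 0) * x j)" for x
      proof (intro restrict_ext)
        fix i assume "i \<in> I"
        have "(\<Sum>j\<in>I. (if j = i then 1 / t else 0) * x j) = (\<Sum>j\<in>I. if j = i then 1 / t * x j else 0)"
          by (intro sum.cong) auto
        then show "x i / t = (\<Sum>j\<in>I. (if j = i then 1 / t else 0) * x j)"
          using \<open>i \<in> I\<close> \<open>finite I\<close> by simp
      qed
      have "(\<integral>\<^sup>+x. g x t \<partial>lborel_PiM I)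
          = (\<integral>\<^sup>+x. indicator E (\<lambda>i\<in>I. x i / t) * ennreal (exp (- t)) \<partial>lborel_PiM I)"
        using True by (simp add: g_def)
      also have "\<dots> = (\<integral>\<^sup>+x. indicator E (\<lambda>i\<in>I. x i / t) \<partial>lborel_PiM I) * ennreal (exp (- t))"
        by (rule nn_integral_multc) measurable
      also have "(\<integral>\<^sup>+x. indicator E (\<lambda>i\<in>I. x i / t) \<partial>lborel_PiM I)
          = (\<Prod>i\<in>I. ennreal (1 / (if i = i then 1 / t else 0))) * (\<integral>\<^sup>+x. indicator E x \<partial>lborel_PiM I)"
        unfolding eq using True \<open>finite I\<close>
        by (intro nn_integral_PiM_triangular[where K = "\<lambda>j i. if j = i then 1 / t else 0"]) auto
      also have "\<dots> = ennreal (t ^ card I) * emeasure (lborel_PiM I) E"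
        using True by (simp add: ennreal_power)
      finally show ?thesis
        using True by (simp add: ennreal_mult mult_ac)
    qed (simp add: g_def)
  qed
  also have "\<dots> = (\<integral>\<^sup>+t. indicator {0<..} t * ennreal (t ^ card I * exp (- t)) \<partial>lborel)
        * emeasure (lborel_PiM I) E"
    by (rule nn_integral_multc) measurable
  finally show ?thesis
    unfolding gS .
qed

lemma nn_integral_exp_Ici:
  assumes "0 < (c::real)"
  shows "(\<integral>\<^sup>+x. indicator {0..} x * ennreal (exp (- c * x)) \<partial>lborel) = ennreal (1 / c)"
proof -
  have "(\<integral>\<^sup>+x. ennreal (exp (- c * x)) * indicator {0..} x \<partial>lborel) = ennreal (0 - (- exp (- c * 0) / c))"
  proof (rule nn_integral_FTC_atLeast)
    show "((\<lambda>x. - exp (- c * x) / c) \<longlongrightarrow> 0) at_top"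
      using assms by real_asymp
  qed (use assms in \<open>auto intro!: derivative_eq_intros\<close>)
  then show ?thesis by (simp add: mult.commute)
qed

text \<open>The rows \<open>K i\<close> generate the cone, and the coordinate \<open>z\<close> is
  recovered from the total being 1. Both slices of the theorem have this form, for the identity
  matrix and for the Kostka matrix.\<close>

definition simplicial_slice :: "'i set \<Rightarrow> 'i \<Rightarrow> ('i \<Rightarrow> 'i \<Rightarrow> real) \<Rightarrow> ('i \<Rightarrow> real) set" where
  "simplicial_slice I z K = {b \<in> I \<rightarrow>\<^sub>E UNIV. \<exists>c. (\<forall>i\<in>insert z I. 0 \<le> c i) \<and>
     (\<forall>j\<in>insert z I. (b(z := 1 - sum b I)) j = (\<Sum>i\<in>insert z I. K i j * c i))}"

section \<open>Volume of a slice of a cone with unitriangular generators\<close>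

context
  fixes I :: "'i::linorder set" and z :: 'i and K :: "'i \<Rightarrow> 'i \<Rightarrow> real"
  assumes fin: "finite I" and z: "z \<notin> I"
    and K_diag: "\<And>i. i \<in> insert z I \<Longrightarrow> K i i = 1"
    and K_tri: "\<And>i j. i \<in> insert z I \<Longrightarrow> j \<in> insert z I \<Longrightarrow> i < j \<Longrightarrow> K i j = 0"
    and K_nonneg: "\<And>i j. 0 \<le> K i j"
begin

lemma K_left_inverse:
  "\<exists>L. \<forall>i\<in>insert z I. \<forall>c. c i = (\<Sum>j\<in>insert z I. L i j * (\<Sum>l\<in>insert z I. K l j * c l))"
  using fin by (intro triangular_left_inverse) (simp_all add: K_diag K_tri del: insert_iff)

lemma simplicial_slice_sets: "simplicial_slice I z K \<in> sets (lborel_PiM I)"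
proof -
  let ?P = "insert z I" and ?hp = "\<lambda>b. b(z := 1 - sum b I)"
  obtain L where L0: "\<forall>i\<in>?P. \<forall>c. c i = (\<Sum>j\<in>?P. L i j * (\<Sum>l\<in>?P. K l j * c l))"
    using K_left_inverse ..
  have L: "\<And>i c. i \<in> ?P \<Longrightarrow> c i = (\<Sum>j\<in>?P. L i j * (\<Sum>l\<in>?P. K l j * c l))"
    by (rule L0[rule_format])
  \<comment> \<open>The quantifier over \<open>c\<close> is eliminated by the only candidate,
    \<open>L\<close> applied to \<open>a\<close>. That \<open>a\<close> really arises from this
    candidate stays as an equation, since \<open>L\<close> is known only as a left inverse. What
    remains is a finite system of linear conditions, hence measurable.\<close>
  have iff: "(\<exists>c. (\<forall>i\<in>?P. 0 \<le> c i) \<and> (\<forall>j\<in>?P. a j = (\<Sum>i\<in>?P. K i j * c i))) \<longleftrightarrow>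
     (\<forall>i\<in>?P. 0 \<le> (\<Sum>j\<in>?P. L i j * a j)) \<and>
     (\<forall>j\<in>?P. a j = (\<Sum>i\<in>?P. K i j * (\<Sum>j\<in>?P. L i j * a j)))" for a
  proof
    assume "\<exists>c. (\<forall>i\<in>?P. 0 \<le> c i) \<and> (\<forall>j\<in>?P. a j = (\<Sum>i\<in>?P. K i j * c i))"
    then obtain c where c: "\<forall>i\<in>?P. 0 \<le> c i"
        and a: "\<forall>j\<in>?P. a j = (\<Sum>i\<in>?P. K i j * c i)" by (elim exE conjE)
    have La: "(\<Sum>j\<in>?P. L i j * a j) = c i" if "i \<in> ?P" for i
      using L[OF that, of c] by (simp only: bspec[OF a] cong: sum.cong)
    have "(\<Sum>i\<in>?P. K i j * (\<Sum>j\<in>?P. L i j * a j)) = (\<Sum>i\<in>?P. K i j * c i)" for j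
      by (intro sum.cong refl) (simp only: La)
    then show "(\<forall>i\<in>?P. 0 \<le> (\<Sum>j\<in>?P. L i j * a j)) \<and>
     (\<forall>j\<in>?P. a j = (\<Sum>i\<in>?P. K i j * (\<Sum>j\<in>?P. L i j * a j)))"
      using a c by (simp only: La cong: ball_cong) simp
  qed (rule exI[of _ "\<lambda>i. \<Sum>j\<in>?P. L i j * a j"])
  define H where "H j b = ?hp b j" for j and b :: "'i \<Rightarrow> real"
  define A where "A i b = (\<Sum>j\<in>?P. L i j * H j b)" for i and b :: "'i \<Rightarrow> real"
  define B where "B j b = (\<Sum>i\<in>?P. K i j * A i b)" for j and b :: "'i \<Rightarrow> real"
  have H [measurable]: "H j \<in> borel_measurable (lborel_PiM I)" if "j \<in> ?P" for j
    unfolding H_def using that by (cases "j = z") simp_all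
  have A [measurable]: "A i \<in> borel_measurable (lborel_PiM I)" for i
    unfolding A_def by (intro borel_measurable_sum borel_measurable_times H) simp_all
  have B [measurable]: "B j \<in> borel_measurable (lborel_PiM I)" for j
    unfolding B_def by measurable
  have eq: "simplicial_slice I z K = {b \<in> space (lborel_PiM I).
       (\<forall>i\<in>?P. 0 \<le> A i b) \<and> (\<forall>j\<in>?P. H j b = B j b)}"
    unfolding simplicial_slice_def iff A_def B_def H_def
    by (simp only: space_PiM space_lborel space_borel)
  have [measurable]: "Measurable.pred (lborel_PiM I) (\<lambda>b. H j b = B j b)" if "j \<in> ?P" for j
    unfolding pred_def by (rule borel_measurable_eq[OF H[OF that] B])
  have "finite ?P" using fin by simp
  then show ?thesis
    unfolding eq by measurable
qed

text \<open>Integrating \<open>exp (- \<Sum> a)\<close> over the cone spanned by the slice and substituting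
  \<open>a = K\<^sup>T c\<close> leaves a product of one-dimensional exponential integrals.\<close>

lemma emeasure_simplicial_slice:
  "(\<integral>\<^sup>+t. indicator {0<..} t * ennreal (t ^ card I * exp (- t)) \<partial>lborel)
      * emeasure (lborel_PiM I) (simplicial_slice I z K)
    = ennreal (\<Prod>i\<in>insert z I. 1 / (\<Sum>j\<in>insert z I. K i j))"
proof -
  interpret product_sigma_finite "\<lambda>_::'i. lborel :: real measure" ..
  let ?P = "insert z I" and ?E = "simplicial_slice I z K"
  note [measurable] = simplicial_slice_sets
  obtain L where L0: "\<forall>i\<in>?P. \<forall>c. c i = (\<Sum>j\<in>?P. L i j * (\<Sum>l\<in>?P. K l j * c l))"
    using K_left_inverse ..
  have L: "\<And>i c. i \<in> ?P \<Longrightarrow> c i = (\<Sum>j\<in>?P. L i j * (\<Sum>l\<in>?P. K l j * c l))"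
    by (rule L0[rule_format])
  define T where "T c = (\<lambda>i\<in>?P. \<Sum>j\<in>?P. K j i * c j)" for c
  define k where "k i = (\<Sum>j\<in>?P. K i j)" for i
  have k_pos: "0 < k i" if "i \<in> ?P" for i
  proof -
    have "K i i \<le> k i"
      unfolding k_def using fin K_nonneg that by (intro member_le_sum) auto
    then show ?thesis using K_diag[OF that] by simp
  qed
  \<comment> \<open>Here the row sums enter: in the coordinates \<open>c\<close> the exponent is
    linear with coefficients \<open>k i\<close>, so the weight factors.\<close>
  have sum_T: "sum (T c) ?P = (\<Sum>i\<in>?P. k i * c i)" for c
  proof -
    have "sum (T c) ?P = (\<Sum>i\<in>?P. \<Sum>j\<in>?P. K j i * c j)"
      unfolding T_def by (intro sum.cong) auto
    also have "\<dots> = (\<Sum>j\<in>?P. \<Sum>i\<in>?P. K j i * c j)"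
      by (rule sum.swap)
    finally show ?thesis by (simp only: k_def sum_distrib_right)
  qed
  \<comment> \<open>Cones are closed under division by the positive total, and \<open>L\<close>
    forces any coefficients of the normalised point to be \<open>c i\<close> over the total.\<close>
  have T_iff: "(\<lambda>i\<in>I. T c i / sum (T c) ?P) \<in> ?E \<longleftrightarrow> (\<forall>i\<in>?P. 0 \<le> c i)"
    if pos: "0 < sum (T c) ?P" for c
  proof -
    let ?t = "sum (T c) ?P"
    let ?b = "\<lambda>i\<in>I. T c i / ?t"
    have "sum ?b I = (?t - T c z) / ?t"
      using fin z by (simp add: sum_divide_distrib)
    then have hp: "(?b(z := 1 - sum ?b I)) j = T c j / ?t" if "j \<in> ?P" for j
      using pos z that by (auto simp: field_simps)
    have T_div: "T c j / ?t = (\<Sum>i\<in>?P. K i j * (c i / ?t))" if "j \<in> ?P" for j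
      using that by (simp only: T_def restrict_apply' sum_divide_distrib times_divide_eq_right)
    have "?b \<in> ?E \<longleftrightarrow> (\<exists>c'. (\<forall>i\<in>?P. 0 \<le> c' i) \<and> (\<forall>j\<in>?P. T c j / ?t = (\<Sum>i\<in>?P. K i j * c' i)))"
      unfolding simplicial_slice_def mem_Collect_eq by (simp only: hp cong: ball_cong) simp
    also have "\<dots> \<longleftrightarrow> (\<forall>i\<in>?P. 0 \<le> c i)"
    proof
      assume "\<forall>i\<in>?P. 0 \<le> c i"
      then show "\<exists>c'. (\<forall>i\<in>?P. 0 \<le> c' i) \<and> (\<forall>j\<in>?P. T c j / ?t = (\<Sum>i\<in>?P. K i j * c' i))"
        using pos by (intro exI[of _ "\<lambda>i. c i / ?t"] conjI ballI T_div divide_nonneg_pos) auto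
    next
      assume "\<exists>c'. (\<forall>i\<in>?P. 0 \<le> c' i) \<and> (\<forall>j\<in>?P. T c j / ?t = (\<Sum>i\<in>?P. K i j * c' i))"
      then obtain c' where c'1: "\<forall>i\<in>?P. 0 \<le> c' i"
        and T': "\<forall>j\<in>?P. T c j / ?t = (\<Sum>i\<in>?P. K i j * c' i)" by (elim exE conjE)
      have c'2: "(\<Sum>i\<in>?P. K i j * (c i / ?t)) = (\<Sum>i\<in>?P. K i j * c' i)" if "j \<in> ?P" for j
        using T_div[OF that] bspec[OF T' that] by (simp only:)
      have "c i / ?t = c' i" if "i \<in> ?P" for i
        using L[OF that, of c'] L[OF that, of "\<lambda>i. c i / ?t"] by (simp only: c'2 cong: sum.cong)
      then show "\<forall>i\<in>?P. 0 \<le> c i"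
        using c'1 pos by (metis divide_nonneg_pos zero_le_divide_iff not_le order_less_imp_le)
    qed
    finally show ?thesis .
  qed
  let ?f = "\<lambda>a. indicator {a. 0 < sum a ?P \<and> (\<lambda>i\<in>I. a i / sum a ?P) \<in> ?E} a
        * ennreal (exp (- sum a ?P))"
  have f_alt: "?f = (\<lambda>a. (if 0 < sum a ?P \<and> (\<lambda>i\<in>I. a i / sum a ?P) \<in> ?E then 1 else 0)
        * ennreal (exp (- sum a ?P)))"
    by (auto simp: fun_eq_iff)
  have f_meas: "?f \<in> borel_measurable (lborel_PiM ?P)"
    unfolding f_alt by measurable
  have "(\<integral>\<^sup>+t. indicator {0<..} t * ennreal (t ^ card I * exp (- t)) \<partial>lborel)
      * emeasure (lborel_PiM I) ?E = (\<integral>\<^sup>+a. ?f a \<partial>lborel_PiM ?P)"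
    by (rule nn_integral_cone[OF fin z simplicial_slice_sets, symmetric])
  \<comment> \<open>The unit diagonal makes the factor of the triangular substitution 1.\<close>
  also have "\<dots> = (\<integral>\<^sup>+c. ?f (T c) \<partial>lborel_PiM ?P)"
    unfolding T_def using fin K_diag K_tri f_meas
    by (subst nn_integral_PiM_triangular[where f = ?f]) auto
  also have "\<dots> = (\<integral>\<^sup>+c. (\<Prod>i\<in>?P. indicator {0..} (c i) * ennreal (exp (- k i * c i))) \<partial>lborel_PiM ?P)"
  proof (rule nn_integral_cong_AE)
    \<comment> \<open>The origin must be removed: there the total is 0, so the left integrand
      vanishes while the right one is 1. Any other \<open>c\<close> with non-negative entries has
      positive total.\<close>
    have "{\<lambda>i\<in>?P. 0} = ?P \<rightarrow>\<^sub>E {0::real}"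
      by (auto simp: PiE_singleton fun_eq_iff)
    moreover have "emeasure (lborel_PiM ?P) (?P \<rightarrow>\<^sub>E {0}) = 0"
      using fin by (subst emeasure_PiM) (auto simp: card_gt_0_iff)
    moreover have "?P \<rightarrow>\<^sub>E {0::real} \<in> sets (lborel_PiM ?P)"
      using fin by (intro sets_PiM_I_finite) auto
    ultimately have "emeasure (lborel_PiM ?P) {\<lambda>i\<in>?P. 0} = 0" "{\<lambda>i\<in>?P. 0::real} \<in> sets (lborel_PiM ?P)"
      by (simp_all only:)
    then have "AE c in lborel_PiM ?P. c \<noteq> (\<lambda>i\<in>?P. 0)"
      by (intro AE_I[of _ _ "{\<lambda>i\<in>?P. 0}"]) auto
    moreover have "AE c in lborel_PiM ?P. c \<in> space (lborel_PiM ?P)"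
      by (rule AE_space)
    ultimately show "AE c in lborel_PiM ?P.
        ?f (T c) = (\<Prod>i\<in>?P. indicator {0..} (c i) * ennreal (exp (- k i * c i)))"
    proof eventually_elim
      fix c :: "'i \<Rightarrow> real" assume c: "c \<noteq> (\<lambda>i\<in>?P. 0)" "c \<in> space (lborel_PiM ?P)"
      show "?f (T c) = (\<Prod>i\<in>?P. indicator {0..} (c i) * ennreal (exp (- k i * c i)))"
      proof (cases "\<forall>i\<in>?P. 0 \<le> c i")
        case True
        from c obtain i where i: "i \<in> ?P" "c i \<noteq> 0"
          by (auto simp: space_PiM PiE_def extensional_def fun_eq_iff restrict_def split: if_splits)
        have "0 < (\<Sum>i\<in>?P. k i * c i)"
        proof (rule sum_pos2[of _ i])
          show "0 < k i * c i" using True i k_pos[of i] by (metis less_eq_real_def mult_pos_pos)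
          show "0 \<le> k j * c j" if "j \<in> ?P" for j
            using bspec[OF True that] k_pos[OF that] by simp
        qed (use fin i in auto)
        then have pos: "0 < sum (T c) ?P" by (simp only: sum_T)
        then have "T c \<in> {a. 0 < sum a ?P \<and> (\<lambda>i\<in>I. a i / sum a ?P) \<in> ?E}"
          using iffD2[OF T_iff[OF pos] True] by (intro CollectI conjI)
        then have "?f (T c) = ennreal (exp (- (\<Sum>i\<in>?P. k i * c i)))"
          by (simp only: sum_T indicator_simps mult_1)
        also have "exp (- (\<Sum>i\<in>?P. k i * c i)) = (\<Prod>i\<in>?P. exp (- k i * c i))"
          using fin by (subst exp_sum[symmetric]) (auto simp: sum_negf)
        also have "ennreal \<dots> = (\<Prod>i\<in>?P. ennreal (exp (- k i * c i)))"
          by (rule prod_ennreal[symmetric]) simp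
        also have "\<dots> = (\<Prod>i\<in>?P. indicator {0..} (c i) * ennreal (exp (- k i * c i)))"
          using True by (intro prod.cong) auto
        finally show ?thesis .
      next
        case False
        then have "T c \<notin> {a. 0 < sum a ?P \<and> (\<lambda>i\<in>I. a i / sum a ?P) \<in> ?E}"
          using T_iff[of c] by blast
        then have "?f (T c) = 0"
          by (simp only: indicator_simps mult_zero_left not_False_eq_True)
        moreover from False obtain i where "i \<in> ?P" "\<not> 0 \<le> c i" by blast
        then have "(\<Prod>i\<in>?P. indicator {0..} (c i) * ennreal (exp (- k i * c i))) = 0"
          using fin by (intro prod_zero) (auto intro!: bexI[of _ i])
        ultimately show ?thesis by (simp only:)
      qed
    qed
  qed
  also have "\<dots> = (\<Prod>i\<in>?P. \<integral>\<^sup>+x. indicator {0..} x * ennreal (exp (- k i * x)) \<partial>lborel)"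
    using fin by (intro product_nn_integral_prod) auto
  also have "\<dots> = (\<Prod>i\<in>?P. ennreal (1 / k i))"
    using k_pos by (intro prod.cong nn_integral_exp_Ici) auto
  also have "\<dots> = ennreal (\<Prod>i\<in>?P. 1 / k i)"
    using k_pos by (intro prod_ennreal) (auto intro: less_imp_le)
  finally show ?thesis unfolding k_def .
qed

end

section \<open>Tableaux and Gelfand--Tsetlin patterns\<close>

definition part_at :: "nat list \<Rightarrow> nat \<Rightarrow> nat" where
  "part_at la i = (if i < length la then la ! i else 0)"

lemma part_antimono:
  assumes "sorted_wrt (\<ge>) la" "i \<le> j"
  shows "part_at la j \<le> part_at la i"
  using assms by (cases "i = j") (auto simp: part_at_def sorted_wrt_iff_nth_less)

lemma in_young_diagram: "(i, j) \<in> young_diagram la \<longleftrightarrow> j < part_at la i"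
  by (auto simp: young_diagram_def part_at_def)

lemma young_diagram_Sigma: "young_diagram la = (SIGMA i:{..<length la}. {..<part_at la i})"
  by (auto simp: young_diagram_def part_at_def)

lemma downward_closed_iff:
  fixes S :: "nat set"
  assumes "finite S" "\<And>i j. j \<in> S \<Longrightarrow> i < j \<Longrightarrow> i \<in> S"
  shows "i < card S \<longleftrightarrow> i \<in> S"
proof -
  have "S = {..<card S}"
  proof (cases "S = {}")
    case False
    then have "Max S \<in> S" "\<And>i. i \<in> S \<Longrightarrow> i \<le> Max S"
      using assms(1) by auto
    then have "S = {..Max S}"
      using assms(2) by (auto simp: le_less)
    then show ?thesis
      by (metis card_atMost lessThan_Suc_atMost)
  qed simp
  then show ?thesis by blast
qed

text \<open>A tableau is encoded by its chain of shapes (a Gelfand--Tsetlin pattern): the \<open>m\<close>-th shape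
  consists of the boxes with entries at most \<open>m\<close>.\<close>

definition gt_patterns :: "nat list \<Rightarrow> (nat \<Rightarrow> nat \<Rightarrow> nat) set" where
  "gt_patterns la = {G. (\<forall>r. G 0 r = 0) \<and> (\<forall>m r. G m r \<le> G (Suc m) r) \<and>
     (\<forall>m r. G (Suc m) (Suc r) \<le> G m r) \<and> (\<exists>M. \<forall>m\<ge>M. \<forall>r. G m r = part_at la r)}"

definition gt_of :: "nat list \<Rightarrow> (nat \<times> nat \<Rightarrow> nat) \<Rightarrow> nat \<Rightarrow> nat \<Rightarrow> nat" where
  "gt_of la T m r = card {j. j < part_at la r \<and> T (r, j) \<le> m}"

text \<open>A box receives the number of the first shape that contains it; this inverts
  \<open>gt_of\<close>.\<close>

definition tableau_of :: "nat list \<Rightarrow> (nat \<Rightarrow> nat \<Rightarrow> nat) \<Rightarrow> nat \<times> nat \<Rightarrow> nat" where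
  "tableau_of la G = (\<lambda>(r, j)\<in>young_diagram la. LEAST m. j < G m r)"

section \<open>Bijection between tableaux and patterns\<close>

lemma ssyt_row: "T \<in> ssyt la \<Longrightarrow> j \<le> j' \<Longrightarrow> j' < part_at la i \<Longrightarrow> T (i, j) \<le> T (i, j')"
  unfolding ssyt_def by (cases "j = j'") (auto simp: in_young_diagram)

lemma ssyt_pos: "T \<in> ssyt la \<Longrightarrow> j < part_at la i \<Longrightarrow> 1 \<le> T (i, j)"
  unfolding ssyt_def by (auto simp: PiE_def Pi_def in_young_diagram)

lemma ssyt_col:
  "T \<in> ssyt la \<Longrightarrow> i < i' \<Longrightarrow> j < part_at la i \<Longrightarrow> j < part_at la i' \<Longrightarrow> T (i, j) < T (i', j)"
  unfolding ssyt_def by (auto simp: in_young_diagram)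

text \<open>Rows increase weakly, so the boxes counted by \<open>gt_of\<close> form an initial
  segment of the row. Inequalities between shapes thus become statements about single boxes.\<close>

lemma less_gt_of_iff:
  assumes "T \<in> ssyt la"
  shows "j < gt_of la T m r \<longleftrightarrow> j < part_at la r \<and> T (r, j) \<le> m"
proof -
  have "T (r, i) \<le> m" if "i < j" "j < part_at la r" "T (r, j) \<le> m" for i j
    using ssyt_row[OF assms, of i j r] that by simp
  then show ?thesis
    unfolding gt_of_def by (subst downward_closed_iff) auto
qed

lemma gt_of_in_gt_patterns:
  assumes "T \<in> ssyt la" "sorted_wrt (\<ge>) la"
  shows "gt_of la T \<in> gt_patterns la"
proof -
  note iff = less_gt_of_iff[OF assms(1)]
  have le_iff: "x \<le> y \<longleftrightarrow> (\<forall>j. j < x \<longrightarrow> j < y)" for x y :: nat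
    by (meson leI less_irrefl order_less_le_trans)
  have "gt_of la T 0 r = 0" for r
    using ssyt_pos[OF assms(1)] by (force simp: gt_of_def)
  moreover have "gt_of la T m r \<le> gt_of la T (Suc m) r" for m r
    unfolding le_iff[of "gt_of _ _ _ _"] iff by auto
  moreover have "gt_of la T (Suc m) (Suc r) \<le> gt_of la T m r" for m r
    unfolding le_iff[of "gt_of _ _ _ _"] iff
  proof (intro allI impI)
    fix j assume j: "j < part_at la (Suc r) \<and> T (Suc r, j) \<le> Suc m"
    then have "j < part_at la r"
      using part_antimono[OF assms(2), of r "Suc r"] by simp
    then show "j < part_at la r \<and> T (r, j) \<le> m"
      using j ssyt_col[OF assms(1), of r "Suc r" j] by auto
  qed
  \<comment> \<open>The shapes are stationary from the largest entry on; 0 is inserted for the empty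
    diagram.\<close>
  moreover have "gt_of la T m r = part_at la r" if "m \<ge> Max (insert 0 (T ` young_diagram la))" for m r
  proof -
    have "T (r, j) \<le> m" if "j < part_at la r" for j
      using \<open>m \<ge> _\<close> that by (simp add: finite_young_diagram in_young_diagram)
    then have "{j. j < part_at la r \<and> T (r, j) \<le> m} = {..<part_at la r}" by auto
    then show ?thesis by (simp add: gt_of_def)
  qed
  ultimately show ?thesis unfolding gt_patterns_def by blast
qed

context
  fixes la G assumes G: "G \<in> gt_patterns la"
begin

lemma gt_0: "G 0 r = 0"
  and gt_Suc: "G m r \<le> G (Suc m) r"
  and gt_diag: "G (Suc m) (Suc r) \<le> G m r"
  and gt_eventually: "\<exists>M. \<forall>m\<ge>M. \<forall>r. G m r = part_at la r"
  using G by (auto simp: gt_patterns_def)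

lemma gt_mono: "m \<le> m' \<Longrightarrow> G m r \<le> G m' r"
  using gt_Suc by (rule lift_Suc_mono_le)

lemma gt_le_part: "G m r \<le> part_at la r"
  using gt_eventually gt_mono by (metis nat_le_linear order_refl)

lemma gt_outside: "length la \<le> r \<Longrightarrow> G m r = 0"
  using gt_le_part[of m r] by (simp add: part_at_def)

text \<open>Shapes grow with \<open>m\<close>, so the levels that contain a box form an up-set, and
  comparing its least element with \<open>m\<close> is membership at level \<open>m\<close>.\<close>

lemma tableau_of_le_iff:
  assumes "j < part_at la r"
  shows "tableau_of la G (r, j) \<le> m \<longleftrightarrow> j < G m r"
proof -
  have "\<exists>m. j < G m r"
    using gt_eventually assms by (metis order_refl)
  then have "j < G (LEAST m. j < G m r) r"
    by (rule LeastI_ex)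
  then have "(LEAST m. j < G m r) \<le> m \<longleftrightarrow> j < G m r"
    using gt_mono by (meson Least_le order_less_le_trans)
  then show ?thesis
    using assms by (simp add: tableau_of_def in_young_diagram)
qed

lemma tableau_of_in_ssyt: "tableau_of la G \<in> ssyt la"
proof -
  have "tableau_of la G \<in> young_diagram la \<rightarrow>\<^sub>E {1..}"
  proof (rule PiE_I)
    fix c assume "c \<in> young_diagram la"
    then obtain r j where c: "c = (r, j)" "j < part_at la r"
      by (metis in_young_diagram surj_pair)
    have "\<not> tableau_of la G c \<le> 0"
      unfolding c tableau_of_le_iff[OF c(2)] by (simp add: gt_0)
    then show "tableau_of la G c \<in> {1..}" by auto
  qed (auto simp: tableau_of_def)
  moreover have "tableau_of la G (i, j) \<le> tableau_of la G (i, j')"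
    if "j < j'" "j < part_at la i" "j' < part_at la i" for i j j'
    unfolding tableau_of_le_iff[OF that(2)]
    using tableau_of_le_iff[OF that(3), of "tableau_of la G (i, j')"] that(1) by simp
  moreover have col: "j < part_at la i \<longrightarrow> j < part_at la i' \<longrightarrow> tableau_of la G (i, j) < tableau_of la G (i', j)"
    if "i < i'" for i i' j
    using that
  proof (induction rule: less_Suc_induct)
    case (1 i)
    show ?case
    proof (intro impI)
      assume j: "j < part_at la i" "j < part_at la (Suc i)"
      \<comment> \<open>Level 0 is empty, so the entry is some \<open>Suc s\<close>; by
        \<open>gt_diag\<close> the box above already lies in shape \<open>s\<close>.\<close>
      let ?t = "tableau_of la G (Suc i, j)"
      have t: "j < G ?t (Suc i)"
        using tableau_of_le_iff[OF j(2), of ?t] by simp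
      then obtain s where s: "?t = Suc s"
        by (metis gt_0 not0_implies_Suc not_less_zero)
      have "j < G s i"
        using t gt_diag[of s i] unfolding s by simp
      then show "tableau_of la G (i, j) < ?t"
        using tableau_of_le_iff[OF j(1), of s] s by simp
    qed
  next
    case (2 i i' i'')
    \<comment> \<open>Chaining through row \<open>i'\<close> requires a box in column
      \<open>j\<close> there. That row lengths decrease is read off from \<open>gt_diag\<close> at a
      level where the pattern has become stationary.\<close>
    have "part_at la i'' \<le> part_at la i'"
    proof -
      obtain M where M: "\<forall>m\<ge>M. \<forall>r. G m r = part_at la r"
        using gt_eventually ..
      have "part_at la (Suc r) \<le> part_at la r" for r
        using gt_diag[of M r] M by simp
      then show ?thesis
        using \<open>i' < i''\<close> by (rule lift_Suc_antimono_le[of "part_at la", OF _ less_imp_le])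
    qed
    then show ?case using 2 by (meson less_trans order_less_le_trans)
  qed
  ultimately show ?thesis
    by (auto simp: ssyt_def in_young_diagram)
qed

lemma gt_of_tableau_of: "gt_of la (tableau_of la G) = G"
proof (intro ext)
  fix m r
  have "{j. j < part_at la r \<and> tableau_of la G (r, j) \<le> m} = {..<G m r}"
    using gt_le_part[of m r] by (auto simp: tableau_of_le_iff)
  then show "gt_of la (tableau_of la G) m r = G m r" by (simp add: gt_of_def)
qed

end

lemma tableau_of_gt_of:
  assumes "T \<in> ssyt la"
  shows "tableau_of la (gt_of la T) = T"
proof
  fix c :: "nat \<times> nat"
  show "tableau_of la (gt_of la T) c = T c"
  proof (cases "c \<in> young_diagram la")
    case True
    then obtain r j where c: "c = (r, j)" "j < part_at la r"
      by (metis in_young_diagram surj_pair)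
    then have "(LEAST m. j < gt_of la T m r) = T (r, j)"
      unfolding less_gt_of_iff[OF assms] by (intro Least_equality) auto
    then show ?thesis using True by (simp add: tableau_of_def c)
  next
    case False
    then show ?thesis
      using assms by (cases c) (auto simp: ssyt_def PiE_def extensional_def tableau_of_def)
  qed
qed

lemma bij_betw_gt_of:
  assumes "sorted_wrt (\<ge>) la"
  shows "bij_betw (gt_of la) (ssyt la) (gt_patterns la)"
  using assms
  by (intro bij_betw_byWitness[where f' = "tableau_of la"])
     (auto simp: tableau_of_gt_of gt_of_tableau_of gt_of_in_gt_patterns tableau_of_in_ssyt)

section \<open>Content of a tableau as growth of its shapes\<close>

lemma weight_0: "T \<in> ssyt la \<Longrightarrow> Poly_Mapping.lookup (tableau_weight la T) 0 = 0"
  using ssyt_pos[of T la] by (auto simp: tableau_weight.rep_eq in_young_diagram Suc_le_eq card_eq_0_iff)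

text \<open>The boxes with entry \<open>Suc m\<close> are those gained between the shapes
  \<open>m\<close> and \<open>Suc m\<close>, counted row by row.\<close>

lemma weight_gt:
  assumes "T \<in> ssyt la"
  shows "(\<Sum>r<length la. gt_of la T (Suc m) r)
    = (\<Sum>r<length la. gt_of la T m r) + Poly_Mapping.lookup (tableau_weight la T) (Suc m)"
proof -
  have "Poly_Mapping.lookup (tableau_weight la T) (Suc m)
      = card (SIGMA r:{..<length la}. {j. j < part_at la r \<and> T (r, j) = Suc m})"
    unfolding tableau_weight.rep_eq young_diagram_Sigma by (rule arg_cong[where f = card]) auto
  also have "\<dots> = (\<Sum>r<length la. card {j. j < part_at la r \<and> T (r, j) = Suc m})"
    by (subst card_SigmaI) auto
  finally have weight: "Poly_Mapping.lookup (tableau_weight la T) (Suc m)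
      = (\<Sum>r<length la. card {j. j < part_at la r \<and> T (r, j) = Suc m})" .
  have "gt_of la T (Suc m) r = gt_of la T m r + card {j. j < part_at la r \<and> T (r, j) = Suc m}" for r
  proof -
    let ?A = "{j. j < part_at la r \<and> T (r, j) \<le> m}"
      and ?B = "{j. j < part_at la r \<and> T (r, j) = Suc m}"
    have "{j. j < part_at la r \<and> T (r, j) \<le> Suc m} = ?A \<union> ?B"
      by auto
    moreover have "card (?A \<union> ?B) = card ?A + card ?B"
      by (rule card_Un_disjoint) auto
    ultimately show ?thesis by (simp add: gt_of_def)
  qed
  then show ?thesis unfolding weight by (simp add: sum.distrib)
qed

text \<open>Kostka numbers for arbitrary contents, as exponent vectors need not be decreasing;
  \<open>w i\<close> counts the entries \<open>Suc i\<close>.\<close>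

definition ssyt_count :: "nat list \<Rightarrow> (nat \<Rightarrow> nat) \<Rightarrow> nat" where
  "ssyt_count la w = card {T \<in> ssyt la. \<forall>i. Poly_Mapping.lookup (tableau_weight la T) (Suc i) = w i}"

lemma kostka_eq_ssyt_count: "kostka la mu = ssyt_count la (part_at mu)"
  by (simp add: kostka_def ssyt_count_def part_at_def)

definition gt_weighted :: "nat list \<Rightarrow> (nat \<Rightarrow> nat) \<Rightarrow> (nat \<Rightarrow> nat \<Rightarrow> nat) set" where
  "gt_weighted la w = {G \<in> gt_patterns la.
     \<forall>i. (\<Sum>r<length la. G (Suc i) r) = (\<Sum>r<length la. G i r) + w i}"

lemma ssyt_count_eq_card_gt:
  assumes "sorted_wrt (\<ge>) la"
  shows "ssyt_count la w = card (gt_weighted la w)"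
proof -
  have "bij_betw (gt_of la) {T \<in> ssyt la. \<forall>i. Poly_Mapping.lookup (tableau_weight la T) (Suc i) = w i}
      (gt_weighted la w)"
    unfolding gt_weighted_def using bij_betw_gt_of[OF assms]
    by (rule bij_betw_Collect) (simp add: weight_gt)
  then show ?thesis unfolding ssyt_count_def by (rule bij_betw_same_card)
qed

text \<open>The Bender--Knuth involution on patterns: the entries of level \<open>p + 1\<close> range independently
  over intervals \<open>[lower, upper]\<close> determined by the levels \<open>p\<close> and \<open>p + 2\<close>, and are reflected in
  them.\<close>

definition gt_lower :: "nat \<Rightarrow> (nat \<Rightarrow> nat \<Rightarrow> nat) \<Rightarrow> nat \<Rightarrow> nat" where
  "gt_lower p G r = max (G (Suc (Suc p)) (Suc r)) (G p r)"

definition gt_upper :: "nat \<Rightarrow> (nat \<Rightarrow> nat \<Rightarrow> nat) \<Rightarrow> nat \<Rightarrow> nat" where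
  "gt_upper p G r = (case r of 0 \<Rightarrow> G (Suc (Suc p)) 0 | Suc s \<Rightarrow> min (G (Suc (Suc p)) r) (G p s))"

definition bender_knuth :: "nat \<Rightarrow> (nat \<Rightarrow> nat \<Rightarrow> nat) \<Rightarrow> nat \<Rightarrow> nat \<Rightarrow> nat" where
  "bender_knuth p G = G(Suc p := \<lambda>r. gt_lower p G r + gt_upper p G r - G (Suc p) r)"

lemma gt_bounds:
  assumes "G \<in> gt_patterns la"
  shows "gt_lower p G r \<le> G (Suc p) r" "G (Suc p) r \<le> gt_upper p G r"
  using gt_Suc[OF assms] gt_diag[OF assms]
  by (auto simp: gt_lower_def gt_upper_def split: nat.split)

lemma bender_knuth_bounds:
  assumes "G \<in> gt_patterns la"
  shows "gt_lower p G r \<le> bender_knuth p G (Suc p) r" "bender_knuth p G (Suc p) r \<le> gt_upper p G r"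
  using gt_bounds[OF assms, of p r] by (auto simp: bender_knuth_def)

lemma bender_knuth_in_gt_patterns:
  assumes G: "G \<in> gt_patterns la"
  shows "bender_knuth p G \<in> gt_patterns la"
proof -
  let ?H = "bender_knuth p G"
  have H: "?H m = G m" if "m \<noteq> Suc p" for m
    using that by (simp add: bender_knuth_def)
  have lower: "G (Suc (Suc p)) (Suc r) \<le> ?H (Suc p) r" "G p r \<le> ?H (Suc p) r" for r
    using bender_knuth_bounds(1)[OF G, of p r] by (auto simp: gt_lower_def)
  have upper: "?H (Suc p) r \<le> G (Suc (Suc p)) r" "?H (Suc p) (Suc r) \<le> G p r" for r
    using bender_knuth_bounds(2)[OF G, of p r] bender_knuth_bounds(2)[OF G, of p "Suc r"]
    by (auto simp: gt_upper_def split: nat.splits)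
  obtain M where M: "\<forall>m\<ge>M. \<forall>r. G m r = part_at la r"
    using gt_eventually[OF G] ..
  have "?H m r = part_at la r" if "m \<ge> max M (Suc (Suc p))" for m r
    using that M H by simp
  moreover have "?H m r \<le> ?H (Suc m) r" for m r
    using gt_Suc[OF G, of m r] lower[of r] upper[of r] H[of m] H[of "Suc m"]
    by (cases "m = Suc p"; cases "m = p") auto
  moreover have "?H (Suc m) (Suc r) \<le> ?H m r" for m r
    using gt_diag[OF G, of m r] lower[of r] upper[of r] H[of m] H[of "Suc m"]
    by (cases "m = Suc p"; cases "m = p") auto
  moreover have "?H 0 r = 0" for r
    using gt_0[OF G] H by simp
  ultimately show ?thesis unfolding gt_patterns_def by blast
qed

text \<open>The interval bounds depend only on the levels \<open>p\<close> and \<open>p + 2\<close>,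
  which the reflection leaves alone.\<close>

lemma bender_knuth_involution:
  assumes G: "G \<in> gt_patterns la"
  shows "bender_knuth p (bender_knuth p G) = G"
proof -
  have "gt_lower p (bender_knuth p G) = gt_lower p G" "gt_upper p (bender_knuth p G) = gt_upper p G"
    by (auto simp: gt_lower_def gt_upper_def bender_knuth_def fun_eq_iff split: nat.split)
  then have "bender_knuth p (bender_knuth p G) m r = G m r" for m r
    using gt_bounds[OF G, of p r] by (simp add: bender_knuth_def)
  then show ?thesis by blast
qed

text \<open>The lower bound in row \<open>L\<close> and the upper bound in row \<open>Suc L\<close>
  are the maximum and the minimum of the same two numbers, so their sum is the sum of these
  numbers.\<close>

lemma sum_lower_upper:
  "(\<Sum>r<L. gt_lower p G r + gt_upper p G r) + gt_upper p G L
    = (\<Sum>r<L. G p r + G (Suc (Suc p)) r) + G (Suc (Suc p)) L"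
proof (induction L)
  case (Suc L)
  have "gt_lower p G L + gt_upper p G (Suc L) = G p L + G (Suc (Suc p)) (Suc L)"
    by (simp add: gt_lower_def gt_upper_def)
  then show ?case using Suc by simp
qed (simp add: gt_upper_def)

text \<open>Beyond the last row all entries vanish, which removes the boundary terms of
  \<open>sum_lower_upper\<close>. The new growth from level \<open>p\<close> to \<open>p + 1\<close>
  is the old growth from \<open>p + 1\<close> to \<open>p + 2\<close>: the two multiplicities are
  exchanged.\<close>

lemma bender_knuth_size:
  assumes G: "G \<in> gt_patterns la"
  shows "(\<Sum>r<length la. bender_knuth p G (Suc p) r) + (\<Sum>r<length la. G (Suc p) r)
    = (\<Sum>r<length la. G p r) + (\<Sum>r<length la. G (Suc (Suc p)) r)"
proof -
  have "gt_upper p G (length la) \<le> G (Suc (Suc p)) (length la)"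
    by (simp add: gt_upper_def split: nat.split)
  then have "gt_upper p G (length la) = 0"
    using gt_outside[OF G, of "length la"] by simp
  then have "(\<Sum>r<length la. gt_lower p G r + gt_upper p G r)
      = (\<Sum>r<length la. G p r) + (\<Sum>r<length la. G (Suc (Suc p)) r)"
    using sum_lower_upper[of p G "length la"] gt_outside[OF G, of "length la"]
    by (simp add: sum.distrib)
  moreover have "(\<Sum>r<length la. gt_lower p G r + gt_upper p G r)
      = (\<Sum>r<length la. bender_knuth p G (Suc p) r + G (Suc p) r)"
    using gt_bounds[OF G] by (intro sum.cong refl) (simp add: bender_knuth_def trans_le_add2)
  ultimately show ?thesis by (simp add: sum.distrib)
qed

lemma bender_knuth_in_gt_weighted:
  assumes "G \<in> gt_weighted la w"
  shows "bender_knuth p G \<in> gt_weighted la (w(p := w (Suc p), Suc p := w p))"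
proof -
  have G: "G \<in> gt_patterns la"
    and w: "\<And>i. (\<Sum>r<length la. G (Suc i) r) = (\<Sum>r<length la. G i r) + w i"
    using assms by (auto simp: gt_weighted_def)
  let ?H = "bender_knuth p G"
  have H: "?H m = G m" if "m \<noteq> Suc p" for m
    using that by (simp add: bender_knuth_def)
  have "(\<Sum>r<length la. ?H (Suc i) r)
      = (\<Sum>r<length la. ?H i r) + (w(p := w (Suc p), Suc p := w p)) i" for i
  proof -
    consider "i = p" | "i = Suc p" | "i \<noteq> p" "i \<noteq> Suc p" by blast
    then show ?thesis
    proof cases
      case 1
      then show ?thesis
        using bender_knuth_size[OF G, of p] w[of p] w[of "Suc p"] H[of p] by simp
    next
      case 2
      then show ?thesis
        using bender_knuth_size[OF G, of p] w[of p] w[of "Suc p"] H[of "Suc (Suc p)"] by simp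
    next
      case 3
      then show ?thesis using w[of i] H[of i] H[of "Suc i"] by simp
    qed
  qed
  then show ?thesis
    using bender_knuth_in_gt_patterns[OF G] by (simp add: gt_weighted_def)
qed

text \<open>This is the symmetry of Schur polynomials in the variables numbered \<open>Suc p\<close>
  and \<open>Suc (Suc p)\<close>.\<close>

lemma ssyt_count_swap:
  assumes "sorted_wrt (\<ge>) la"
  shows "ssyt_count la (w(p := w (Suc p), Suc p := w p)) = ssyt_count la w"
proof -
  let ?s = "\<lambda>w :: nat \<Rightarrow> nat. w(p := w (Suc p), Suc p := w p)"
  have "?s (?s w) = w" by (auto simp: fun_eq_iff)
  then have "bij_betw (bender_knuth p) (gt_weighted la w) (gt_weighted la (?s w))"
    using bender_knuth_in_gt_weighted[of _ la w p] bender_knuth_in_gt_weighted[of _ la "?s w" p]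
    by (intro bij_betw_byWitness[where f' = "bender_knuth p"])
       (auto simp: bender_knuth_involution gt_weighted_def)
  then show ?thesis
    unfolding ssyt_count_eq_card_gt[OF assms] using bij_betw_same_card by metis
qed

text \<open>Adjacent transpositions generate all rearrangements: the head of \<open>ys\<close> is
  found in \<open>xs\<close> and moved to the front, and the tails are treated recursively.\<close>

lemma swap_invariant_imp_mset_invariant:
  assumes swap: "\<And>us a b vs. f (us @ a # b # vs) = f (us @ b # a # vs)"
    and "mset xs = mset ys"
  shows "f xs = f ys"
proof -
  have move: "f (zs @ us @ y # vs) = f (zs @ y # us @ vs)" for zs us y vs
  proof (induction us arbitrary: zs)
    case (Cons u us)
    have "f (zs @ (u # us) @ y # vs) = f (zs @ u # y # us @ vs)"
      using Cons.IH[of "zs @ [u]"] by simp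
    then show ?case
      using swap[of zs u y "us @ vs"] by simp
  qed simp
  \<comment> \<open>The prefix \<open>zs\<close> collects the entries already in place.\<close>
  have "f (zs @ xs) = f (zs @ ys)" for zs
    using \<open>mset xs = mset ys\<close>
  proof (induction ys arbitrary: xs zs)
    case (Cons y ys)
    then have "y \<in> set xs" by (metis list.set_intros(1) set_mset_mset)
    then obtain us vs where xs: "xs = us @ y # vs" by (meson split_list)
    with Cons.prems have "mset (us @ vs) = mset ys" by simp
    then have "f ((zs @ [y]) @ us @ vs) = f ((zs @ [y]) @ ys)" by (rule Cons.IH)
    then show ?case using move xs by simp
  qed simp
  from this[of "[]"] show ?thesis by simp
qed

lemma ssyt_count_mset:
  assumes "sorted_wrt (\<ge>) la" "mset xs = mset ys"
  shows "ssyt_count la (part_at xs) = ssyt_count la (part_at ys)"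
proof (rule swap_invariant_imp_mset_invariant[OF _ assms(2)])
  fix us vs :: "nat list" and a b
  let ?p = "length us" and ?w = "part_at (us @ b # a # vs)"
  have "part_at (us @ a # b # vs) = ?w(?p := ?w (Suc ?p), Suc ?p := ?w ?p)"
    by (auto simp: fun_eq_iff part_at_def nth_append nth_Cons split: nat.split)
  then show "ssyt_count la (part_at (us @ a # b # vs)) = ssyt_count la ?w"
    using ssyt_count_swap[OF assms(1)] by metis
qed

section \<open>Unitriangularity of the Kostka matrix\<close>

lemma partitionsD:
  assumes "la \<in> partitions k"
  shows "sorted_wrt (\<ge>) la" "\<And>p. p \<in> set la \<Longrightarrow> 0 < p" "sum_list la = k"
  using assms by (auto simp: partitions_def)

text \<open>Columns increase strictly from at least 1, so entries at most \<open>m\<close> occupy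
  only the first \<open>m\<close> rows.\<close>

lemma gt_triangular:
  assumes G: "G \<in> gt_patterns la"
  shows "m \<le> r \<Longrightarrow> G m r = 0"
proof (induction m arbitrary: r)
  case (Suc m)
  then obtain s where "r = Suc s" "m \<le> s" by (metis Suc_le_D Suc_le_mono)
  then show ?case using Suc.IH[of s] gt_diag[OF G, of m s] by simp
qed (simp add: gt_0[OF G])

lemma gt_weighted_size:
  assumes "G \<in> gt_weighted la w"
  shows "(\<Sum>r<length la. G m r) = (\<Sum>i<m. w i)"
  using assms by (induction m) (auto simp: gt_weighted_def gt_0)

lemma gt_size:
  assumes "G \<in> gt_patterns la"
  shows "(\<Sum>r<length la. G m r) = (\<Sum>r<m. G m r)"
  using gt_triangular[OF assms, of m] gt_outside[OF assms, of _ m]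
  by (intro sum.mono_neutral_cong) auto

lemma gt_weighted_ex:
  assumes "sorted_wrt (\<ge>) la" "ssyt_count la w \<noteq> 0"
  obtains G where "G \<in> gt_weighted la w"
  using assms by (metis ssyt_count_eq_card_gt card.empty ex_in_conv)

text \<open>The left side counts the entries at most \<open>m\<close>; by
  \<open>gt_triangular\<close> they all fit into the first \<open>m\<close> rows.\<close>

lemma kostka_imp_dominance:
  assumes "sorted_wrt (\<ge>) la" "kostka la mu \<noteq> 0"
  shows "(\<Sum>i<m. part_at mu i) \<le> (\<Sum>i<m. part_at la i)"
proof -
  obtain G where G: "G \<in> gt_weighted la (part_at mu)"
    using gt_weighted_ex assms unfolding kostka_eq_ssyt_count by metis
  then have "G \<in> gt_patterns la" by (simp add: gt_weighted_def)
  then have "(\<Sum>i<m. part_at mu i) = (\<Sum>r<m. G m r)"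
    using gt_size gt_weighted_size[OF G] by metis
  then show ?thesis
    using gt_le_part[OF \<open>G \<in> gt_patterns la\<close>] by (simp add: sum_mono)
qed

text \<open>The order on lists is lexicographic, so the first differing part decides. Positivity of
  the parts of \<open>mu\<close> ensures that \<open>la\<close> does not end before
  \<open>mu\<close> while they agree.\<close>

lemma dominance_imp_lex_le:
  assumes "\<And>p. p \<in> set mu \<Longrightarrow> 0 < p"
    and "\<And>m. (\<Sum>i<m. part_at mu i) \<le> (\<Sum>i<m. part_at la i)"
  shows "mu \<le> la"
  using assms
proof (induction mu arbitrary: la)
  case (Cons a mu)
  have a: "0 < a" "a \<le> part_at la 0"
    using Cons.prems(1)[of a] Cons.prems(2)[of 1] by (auto simp: part_at_def)
  then obtain b la' where la: "la = b # la'" "a \<le> b"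
    by (cases la) (auto simp: part_at_def)
  have shift: "part_at (x # xs) (Suc i) = part_at xs i" "part_at (x # xs) 0 = x" for x xs i
    by (auto simp: part_at_def)
  show ?case
  proof (cases "a = b")
    case True
    have "(\<Sum>i<m. part_at mu i) \<le> (\<Sum>i<m. part_at la' i)" for m
      using Cons.prems(2)[of "Suc m"] True by (simp add: la sum.lessThan_Suc_shift shift del: sum.lessThan_Suc)
    then have "mu \<le> la'"
      using Cons.prems(1) by (intro Cons.IH) auto
    then show ?thesis by (simp add: la True)
  qed (use la in simp)
qed simp

lemma kostka_triangular:
  assumes "la \<in> partitions k" "mu \<in> partitions k" "la < mu"
  shows "kostka la mu = 0"
  using kostka_imp_dominance[of la mu] dominance_imp_lex_le[of mu la] partitionsD[OF assms(1)]
    partitionsD[OF assms(2)] assms(3) by (meson leD)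

text \<open>For content \<open>la\<close> the dominance bound is an equality at every level, so
  every row bound is attained. This leaves the pattern \<open>D\<close>, whose shape
  \<open>m\<close> is the first \<open>m\<close> rows of \<open>la\<close>: the tableau with
  \<open>Suc r\<close> throughout row \<open>r\<close>.\<close>

lemma kostka_diagonal:
  assumes "la \<in> partitions k"
  shows "kostka la la = 1"
proof -
  define D where "D m r = (if r < m then part_at la r else 0)" for m r
  note la = partitionsD[OF assms]
  have D: "D \<in> gt_patterns la"
  proof -
    have "\<exists>M. \<forall>m\<ge>M. \<forall>r. D m r = part_at la r"
      by (intro exI[of _ "length la"]) (simp add: D_def part_at_def)
    moreover have "D (Suc m) (Suc r) \<le> D m r" for m r
      using part_antimono[OF la(1), of r "Suc r"] by (simp add: D_def)
    ultimately show ?thesis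
      by (simp add: gt_patterns_def) (simp add: D_def)
  qed
  have "(\<Sum>r<length la. D m r) = (\<Sum>r<m. part_at la r)" for m
    unfolding gt_size[OF D] by (simp add: D_def)
  then have "D \<in> gt_weighted la (part_at la)"
    using D by (simp add: gt_weighted_def)
  moreover have "G = D" if G: "G \<in> gt_weighted la (part_at la)" for G
  proof -
    have pat: "G \<in> gt_patterns la" using G by (simp add: gt_weighted_def)
    have eq: "(\<Sum>r<m. G m r) = (\<Sum>r<m. part_at la r)" for m
      using gt_size[OF pat] gt_weighted_size[OF G] by metis
    have "G m r = D m r" for m r
    proof (cases "r < m")
      case True
      then have "G m r = part_at la r"
        using sum_mono_inv[OF eq[of m] gt_le_part[OF pat], of r] by simp
      then show ?thesis using True by (simp add: D_def)
    qed (simp add: D_def gt_triangular[OF pat])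
    then show ?thesis by blast
  qed
  ultimately have "gt_weighted la (part_at la) = {D}" by blast
  then show ?thesis
    unfolding kostka_eq_ssyt_count ssyt_count_eq_card_gt[OF la(1)] by simp
qed

section \<open>Expansion of Schur polynomials in monomial symmetric polynomials\<close>

text \<open>The expression inside \<open>monomial_exponents\<close>, isolated so that these sets
  become fibres of a function and each exponent vector meets exactly one partition.\<close>

definition exponent_type :: "nat \<Rightarrow> (nat \<Rightarrow>\<^sub>0 nat) \<Rightarrow> nat list" where
  "exponent_type n \<alpha> =
     rev (sort (filter (\<lambda>e. e \<noteq> 0) (map (Poly_Mapping.lookup \<alpha>) [1..<Suc n])))"

lemma monomial_exponents_iff:
  "\<alpha> \<in> monomial_exponents n la \<longleftrightarrow> Poly_Mapping.keys \<alpha> \<subseteq> {1..n} \<and> exponent_type n \<alpha> = la"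
  by (simp add: monomial_exponents_def exponent_type_def del: upt_Suc)

lemma exponent_type_in_partitions:
  "exponent_type n \<alpha> \<in> partitions (\<Sum>i<n. Poly_Mapping.lookup \<alpha> (Suc i))"
proof -
  let ?xs = "map (Poly_Mapping.lookup \<alpha>) [1..<Suc n]"
  have nonzero: "sum_list (filter (\<lambda>e. e \<noteq> 0) xs) = sum_list xs" for xs :: "nat list"
    by (induction xs) auto
  have "sum_list (exponent_type n \<alpha>) = sum_list (filter (\<lambda>e. e \<noteq> 0) ?xs)"
    unfolding exponent_type_def by (metis mset_rev mset_sort sum_mset_sum_list)
  also have "\<dots> = sum_list ?xs"
    by (rule nonzero)
  also have "\<dots> = (\<Sum>i<n. Poly_Mapping.lookup \<alpha> (Suc i))"
    by (induction n) auto
  moreover have "sorted_wrt (\<ge>) (exponent_type n \<alpha>)"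
    by (simp add: exponent_type_def sorted_wrt_rev del: upt_Suc)
  ultimately show ?thesis
    by (auto simp: partitions_def exponent_type_def simp del: upt_Suc)
qed

text \<open>A partition of \<open>k\<close> has at most \<open>k\<close> parts, hence fits into
  \<open>n\<close> variables.\<close>

lemma exponent_of_partition:
  assumes "mu \<in> partitions k" "k \<le> n"
  obtains \<alpha> where "\<alpha> \<in> monomial_exponents n mu"
proof -
  note mu = partitionsD[OF assms(1)]
  have "length xs \<le> sum_list xs" if "\<forall>p\<in>set xs. 0 < p" for xs :: "nat list"
    using that by (induction xs) auto
  then have len: "length mu \<le> n"
    using mu(2,3) assms(2) by (metis order_trans)
  \<comment> \<open>The parts of \<open>mu\<close> shifted by one, since variables are numbered from
    1.\<close>
  define g where "g i = (case i of 0 \<Rightarrow> 0 | Suc j \<Rightarrow> part_at mu j)" for i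
  have g: "g i = 0" if "i \<notin> {1..n}" for i
    using that len by (auto simp: g_def part_at_def split: nat.split)
  then have "finite {i. g i \<noteq> 0}"
    by (metis (mono_tags, lifting) finite_atLeastAtMost finite_subset mem_Collect_eq subsetI)
  then have lk: "Poly_Mapping.lookup (Abs_poly_mapping g) = g"
    by (simp add: Abs_poly_mapping_inverse)
  have "map g [1..<Suc n] = mu @ replicate (n - length mu) 0"
    using len by (intro nth_equalityI) (auto simp: g_def part_at_def nth_append simp del: upt_Suc)
  then have "filter (\<lambda>e. e \<noteq> 0) (map g [1..<Suc n]) = mu"
    using mu(2) by (simp add: filter_id_conv del: upt_Suc)
  moreover have "sort mu = rev mu"
    using mu(1) by (intro properties_for_sort) (auto simp: sorted_wrt_rev)
  ultimately have "exponent_type n (Abs_poly_mapping g) = mu"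
    by (simp add: exponent_type_def lk del: upt_Suc)
  moreover have "Poly_Mapping.keys (Abs_poly_mapping g) \<subseteq> {1..n}"
    using g by (force simp: in_keys_iff lk)
  ultimately show ?thesis
    using that by (simp add: monomial_exponents_iff)
qed

section \<open>Coefficients of monomial combinations and of Schur polynomials\<close>

lemma lookup_const_poly_mult:
  "Poly_Mapping.lookup (const_poly a * p) \<alpha> = a * Poly_Mapping.lookup p \<alpha>"
  by (simp add: const_poly_def map.rep_eq when_def flip: mult_map_scale_conv_mult)

lemma lookup_monomial_sym:
  "Poly_Mapping.lookup (monomial_sym n la) \<alpha> = of_bool (\<alpha> \<in> monomial_exponents n la)"
  by (simp add: monomial_sym_def lookup_sum lookup_single when_def finite_monomial_exponents)

lemma lookup_monomial_comb:
  "Poly_Mapping.lookup (monomial_comb n k a) \<alpha> =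
     (if Poly_Mapping.keys \<alpha> \<subseteq> {1..n} \<and> exponent_type n \<alpha> \<in> partitions k
      then a (exponent_type n \<alpha>) else 0)"
proof -
  have "Poly_Mapping.lookup (monomial_comb n k a) \<alpha> = (\<Sum>la\<in>partitions k.
      if exponent_type n \<alpha> = la then if Poly_Mapping.keys \<alpha> \<subseteq> {1..n} then a la else 0 else 0)"
    unfolding monomial_comb_def lookup_sum lookup_const_poly_mult lookup_monomial_sym
    by (intro sum.cong) (auto simp: monomial_exponents_iff)
  then show ?thesis
    by (simp add: finite_partitions)
qed

text \<open>Linear independence: one exponent vector of type \<open>mu\<close> reads off the
  coefficient \<open>a mu\<close>, and \<open>k \<le> n\<close> provides such a vector.\<close>

lemma monomial_comb_eq_iff:
  assumes "k \<le> n"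
  shows "monomial_comb n k a = monomial_comb n k a' \<longleftrightarrow> (\<forall>mu\<in>partitions k. a mu = a' mu)"
proof
  assume eq: "monomial_comb n k a = monomial_comb n k a'"
  show "\<forall>mu\<in>partitions k. a mu = a' mu"
  proof
    fix mu assume mu: "mu \<in> partitions k"
    then obtain \<alpha> where "\<alpha> \<in> monomial_exponents n mu"
      using exponent_of_partition assms by blast
    then show "a mu = a' mu"
      using mu arg_cong[OF eq, of "\<lambda>f. Poly_Mapping.lookup f \<alpha>"]
      by (simp add: lookup_monomial_comb monomial_exponents_iff)
  qed
qed (auto intro!: poly_mapping_eqI simp: lookup_monomial_comb)

lemma lookup_schur:
  "Poly_Mapping.lookup (schur n la) \<alpha> = (if Poly_Mapping.keys \<alpha> \<subseteq> {1..n}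
     then real (ssyt_count la (\<lambda>i. Poly_Mapping.lookup \<alpha> (Suc i))) else 0)"
proof -
  have keys: "Poly_Mapping.keys (tableau_weight la T) = T ` young_diagram la" for T
    by (force simp: in_keys_iff tableau_weight.rep_eq card_eq_0_iff finite_young_diagram)
  have "Poly_Mapping.lookup (schur n la) \<alpha> = real (card {T \<in> ssyt_upto n la. tableau_weight la T = \<alpha>})"
    using finite_ssyt_upto[of n la]
    by (simp add: schur_def lookup_sum lookup_single when_def sum.If_cases Int_def)
  also have "{T \<in> ssyt_upto n la. tableau_weight la T = \<alpha>} =
      (if Poly_Mapping.keys \<alpha> \<subseteq> {1..n} then {T \<in> ssyt la. tableau_weight la T = \<alpha>} else {})"
    by (auto simp: ssyt_upto_def keys[symmetric])
  also have "{T \<in> ssyt la. tableau_weight la T = \<alpha>} = {T \<in> ssyt la.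
      \<forall>i. Poly_Mapping.lookup (tableau_weight la T) (Suc i) = Poly_Mapping.lookup \<alpha> (Suc i)}"
    if "Poly_Mapping.keys \<alpha> \<subseteq> {1..n}"
  proof -
    have "Poly_Mapping.lookup \<alpha> 0 = 0" using that by (force simp: in_keys_iff)
    then show ?thesis
      by (auto intro!: poly_mapping_eqI) (metis not0_implies_Suc weight_0)
  qed
  ultimately show ?thesis by (simp add: ssyt_count_def)
qed

text \<open>The coefficient at an exponent vector counts tableaux with that content. By symmetry
  only the multiset of exponents matters, so the count is the Kostka number of its type.\<close>

lemma schur_eq_kostka_comb:
  assumes "la \<in> partitions k"
  shows "schur n la = monomial_comb n k (\<lambda>mu. real (kostka la mu))"
proof (rule poly_mapping_eqI)
  fix \<alpha> :: "nat \<Rightarrow>\<^sub>0 nat"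
  note la = partitionsD[OF assms]
  let ?w = "\<lambda>i. Poly_Mapping.lookup \<alpha> (Suc i)" and ?mu = "exponent_type n \<alpha>"
  show "Poly_Mapping.lookup (schur n la) \<alpha>
      = Poly_Mapping.lookup (monomial_comb n k (\<lambda>mu. real (kostka la mu))) \<alpha>"
  proof (cases "Poly_Mapping.keys \<alpha> \<subseteq> {1..n}")
    case True
    let ?xs = "map (Poly_Mapping.lookup \<alpha>) [1..<Suc n]"
    have outside: "?w i = 0" if "n \<le> i" for i
      using True that by (force simp: in_keys_iff)
    have w: "?w = part_at ?xs"
      using outside by (auto simp: part_at_def fun_eq_iff simp del: upt_Suc)
    \<comment> \<open>Up to order the exponents are their type followed by zeros, and
      \<open>part_at\<close> ignores trailing zeros.\<close>
    have filt: "mset xs = mset (filter (\<lambda>e. e \<noteq> 0) xs @ replicate (count (mset xs) 0) 0)"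
      for xs :: "nat list"
      by (induction xs) auto
    have "mset ?xs = mset (?mu @ replicate (count (mset ?xs) 0) 0)"
      unfolding exponent_type_def using filt[of ?xs] by (simp del: upt_Suc)
    then have "ssyt_count la ?w = ssyt_count la (part_at (?mu @ replicate (count (mset ?xs) 0) 0))"
      unfolding w by (rule ssyt_count_mset[OF la(1)])
    also have "part_at (us @ replicate c 0) = part_at us" for us c
      by (auto simp: part_at_def nth_append fun_eq_iff)
    finally have "ssyt_count la ?w = kostka la ?mu"
      by (simp add: kostka_eq_ssyt_count)
    \<comment> \<open>A tableau with this content has as many boxes as the exponents add up to, so
      the degree is \<open>k\<close>.\<close>
    moreover have "?mu \<in> partitions k" if nz: "ssyt_count la ?w \<noteq> 0"
    proof -
      obtain G where G: "G \<in> gt_weighted la ?w"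
        using gt_weighted_ex la(1) nz by metis
      then have pat: "G \<in> gt_patterns la" by (simp add: gt_weighted_def)
      obtain M where M: "\<forall>m\<ge>M. \<forall>r. G m r = part_at la r"
        using gt_eventually[OF pat] ..
      have "(\<Sum>i<n. ?w i) = (\<Sum>i<max M n. ?w i)"
        using outside by (intro sum.mono_neutral_left) auto
      also have "\<dots> = (\<Sum>r<length la. part_at la r)"
        using gt_weighted_size[OF G, of "max M n"] M by simp
      also have "\<dots> = k"
        using la(3) by (simp add: part_at_def sum_list_sum_nth atLeast0LessThan)
      finally show ?thesis
        using exponent_type_in_partitions[of n \<alpha>] by simp
    qed
    ultimately show ?thesis
      using True by (auto simp: lookup_schur lookup_monomial_comb)
  qed (simp add: lookup_schur lookup_monomial_comb)
qed

lemma schur_comb: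
  "(\<Sum>la\<in>partitions k. const_poly (c la) * schur n la)
    = monomial_comb n k (\<lambda>mu. \<Sum>la\<in>partitions k. real (kostka la mu) * c la)"
proof (rule poly_mapping_eqI)
  fix \<alpha> :: "nat \<Rightarrow>\<^sub>0 nat"
  have "(\<Sum>la\<in>partitions k. const_poly (c la) * schur n la)
      = (\<Sum>la\<in>partitions k. const_poly (c la) * monomial_comb n k (\<lambda>mu. real (kostka la mu)))"
    by (simp add: schur_eq_kostka_comb)
  then show "Poly_Mapping.lookup (\<Sum>la\<in>partitions k. const_poly (c la) * schur n la) \<alpha>
    = Poly_Mapping.lookup
        (monomial_comb n k (\<lambda>mu. \<Sum>la\<in>partitions k. real (kostka la mu) * c la)) \<alpha>"
    by (simp only: lookup_sum lookup_const_poly_mult lookup_monomial_comb)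
      (cases "Poly_Mapping.keys \<alpha> \<subseteq> {1..n} \<and> exponent_type n \<alpha> \<in> partitions k";
       simp only: simp_thms if_True if_False mult.commute mult_zero_left sum.neutral_const)
qed

section \<open>The two slices\<close>

lemma row_in_partitions: "1 \<le> k \<Longrightarrow> [k] \<in> partitions k"
  by (simp add: partitions_def)

lemma insert_row_chart_index: "1 \<le> k \<Longrightarrow> insert [k] (chart_index k) = partitions k"
  using row_in_partitions by (auto simp: chart_index_def)

lemma sum_hyperplane_point:
  assumes "1 \<le> k"
  shows "(\<Sum>la\<in>partitions k. hyperplane_point k b la) = 1"
proof -
  have "(\<Sum>la\<in>chart_index k. hyperplane_point k b la) = (\<Sum>la\<in>chart_index k. b la)"
    by (intro sum.cong) (auto simp: hyperplane_point_def chart_index_def)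
  moreover have "finite (chart_index k)" "[k] \<notin> chart_index k"
    by (auto simp: chart_index_def finite_partitions)
  ultimately show ?thesis
    unfolding insert_row_chart_index[OF assms, symmetric] by (simp add: hyperplane_point_def)
qed

lemma M_slice_iff:
  assumes "1 \<le> k" "k \<le> n"
  shows "monomial_comb n k (hyperplane_point k b) \<in> M_slice n k
    \<longleftrightarrow> (\<forall>la\<in>partitions k. 0 \<le> hyperplane_point k b la)" (is "?L \<longleftrightarrow> ?R")
proof
  assume ?L
  then obtain a where "monomial_comb n k (hyperplane_point k b) = monomial_comb n k a"
      "\<forall>la\<in>partitions k. 0 \<le> a la"
    by (auto simp: M_slice_def)
  then show ?R using assms(2) by (simp add: monomial_comb_eq_iff)
next
  assume ?R
  then show ?L
    unfolding M_slice_def using sum_hyperplane_point[OF assms(1)] by blast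
qed

lemma S_slice_iff:
  assumes "1 \<le> k" "k \<le> n"
  shows "monomial_comb n k (hyperplane_point k b) \<in> S_slice n k
    \<longleftrightarrow> (\<exists>c. (\<forall>la\<in>partitions k. 0 \<le> c la) \<and> (\<forall>mu\<in>partitions k.
      hyperplane_point k b mu = (\<Sum>la\<in>partitions k. real (kostka la mu) * c la)))" (is "_ \<longleftrightarrow> ?R")
proof -
  \<comment> \<open>Kostka numbers are non-negative, so non-negative Schur coefficients give
    non-negative monomial coordinates; this supplies the membership in \<open>M_slice\<close> that
    \<open>S_slice\<close> demands.\<close>
  have "0 \<le> hyperplane_point k b mu" if ?R "mu \<in> partitions k" for mu
    using that by (auto intro!: sum_nonneg)
  then show ?thesis
    unfolding S_slice_def mem_Collect_eq M_slice_iff[OF assms] schur_positive_def schur_comb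
      monomial_comb_eq_iff[OF assms(2)]
    by blast
qed

theorem theorem4p1:
  fixes n k :: nat
  assumes "k \<ge> 1" and "n \<ge> k"
  shows "hyperplane_vol n k (S_slice n k) / hyperplane_vol n k (M_slice n k)
         = (\<Prod>la\<in>partitions k. 1 / real (kostka_sum k la))"
proof -
  let ?I = "chart_index k"
  have fin: "finite ?I" and z: "[k] \<notin> ?I"
    by (auto simp: chart_index_def finite_partitions)
  note ins = insert_row_chart_index[OF assms(1)]
  \<comment> \<open>Generators of the two cones in monomial coordinates: \<open>KM\<close> is the
    identity matrix, \<open>KS\<close> the Kostka matrix. The constant \<open>C\<close> is shared,
    as both slices lie in the same chart.\<close>
  define KM :: "nat list \<Rightarrow> nat list \<Rightarrow> real" where "KM la mu = of_bool (la = mu)" for la mu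
  define KS :: "nat list \<Rightarrow> nat list \<Rightarrow> real" where "KS la mu = real (kostka la mu)" for la mu
  define C where "C = (\<integral>\<^sup>+t. indicator {0<..} t * ennreal (t ^ card ?I * exp (- t)) \<partial>lborel)"
  have C: "C * emeasure (lborel_PiM ?I) (simplicial_slice ?I [k] K)
        = ennreal (\<Prod>i\<in>partitions k. 1 / (\<Sum>j\<in>partitions k. K i j))"
    and sets: "simplicial_slice ?I [k] K \<in> sets (lborel_PiM ?I)"
    if "\<And>i. i \<in> partitions k \<Longrightarrow> K i i = 1"
      "\<And>i j. i \<in> partitions k \<Longrightarrow> j \<in> partitions k \<Longrightarrow> i < j \<Longrightarrow> K i j = 0" "\<And>i j. 0 \<le> K i j" for K
    using emeasure_simplicial_slice[OF fin z, of K] simplicial_slice_sets[OF fin z, of K] that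
    unfolding ins C_def by blast+
  have KM: "\<And>i. i \<in> partitions k \<Longrightarrow> KM i i = 1"
      "\<And>i j. i \<in> partitions k \<Longrightarrow> j \<in> partitions k \<Longrightarrow> i < j \<Longrightarrow> KM i j = 0" "\<And>i j. 0 \<le> KM i j"
    by (auto simp: KM_def)
  have KS: "\<And>i. i \<in> partitions k \<Longrightarrow> KS i i = 1"
      "\<And>i j. i \<in> partitions k \<Longrightarrow> j \<in> partitions k \<Longrightarrow> i < j \<Longrightarrow> KS i j = 0" "\<And>i j. 0 \<le> KS i j"
    by (auto simp: KS_def kostka_diagonal kostka_triangular)
  have slice: "simplicial_slice ?I [k] K = {b \<in> ?I \<rightarrow>\<^sub>E UNIV. \<exists>c. (\<forall>la\<in>partitions k. 0 \<le> c la) \<and>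
      (\<forall>mu\<in>partitions k. hyperplane_point k b mu = (\<Sum>la\<in>partitions k. K la mu * c la))}" for K
    unfolding simplicial_slice_def ins hyperplane_point_def ..
  have M: "{b \<in> ?I \<rightarrow>\<^sub>E UNIV. monomial_comb n k (hyperplane_point k b) \<in> M_slice n k}
      = simplicial_slice ?I [k] KM"
  proof -
    have "(\<Sum>la\<in>partitions k. KM la mu * c la) = c mu" if "mu \<in> partitions k" for mu c
    proof -
      have "(\<Sum>la\<in>partitions k. KM la mu * c la) = (\<Sum>la\<in>partitions k. if la = mu then c la else 0)"
        by (intro sum.cong) (auto simp: KM_def)
      then show ?thesis using that by (simp add: finite_partitions)
    qed
    then have "(\<exists>c. (\<forall>la\<in>partitions k. 0 \<le> c la) \<and>
          (\<forall>mu\<in>partitions k. a mu = (\<Sum>la\<in>partitions k. KM la mu * c la)))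
        \<longleftrightarrow> (\<forall>la\<in>partitions k. 0 \<le> a la)" for a
      by (simp only: cong: ball_cong) (auto intro!: exI[of _ a])
    then show ?thesis
      unfolding slice M_slice_iff[OF assms] by simp
  qed
  have S: "{b \<in> ?I \<rightarrow>\<^sub>E UNIV. monomial_comb n k (hyperplane_point k b) \<in> S_slice n k}
      = simplicial_slice ?I [k] KS"
    unfolding slice S_slice_iff[OF assms] KS_def ..
  \<comment> \<open>The slices are measurable for the product measure itself, so its completion
    assigns them the same value.\<close>
  have volM: "hyperplane_vol n k (M_slice n k) = enn2real (emeasure (lborel_PiM ?I) (simplicial_slice ?I [k] KM))"
    unfolding hyperplane_vol_def M by (simp add: measure_def sets KM)
  have volS: "hyperplane_vol n k (S_slice n k) = enn2real (emeasure (lborel_PiM ?I) (simplicial_slice ?I [k] KS))"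
    unfolding hyperplane_vol_def S by (simp add: measure_def sets KS)
  have "enn2real C * hyperplane_vol n k (M_slice n k) = 1"
  proof -
    have "(\<Sum>j\<in>partitions k. KM i j) = 1" if "i \<in> partitions k" for i
      using that by (simp add: KM_def of_bool_def finite_partitions)
    then have "C * emeasure (lborel_PiM ?I) (simplicial_slice ?I [k] KM) = 1"
      by (subst C) (auto intro: KM)
    then show ?thesis
      unfolding volM enn2real_mult[symmetric] by simp
  qed
  moreover have "enn2real C * hyperplane_vol n k (S_slice n k)
      = (\<Prod>la\<in>partitions k. 1 / real (kostka_sum k la))"
  proof -
    have "real (kostka_sum k la) = (\<Sum>mu\<in>partitions k. KS la mu)" for la
      by (simp add: kostka_sum_def KS_def)
    then have "C * emeasure (lborel_PiM ?I) (simplicial_slice ?I [k] KS)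
        = ennreal (\<Prod>la\<in>partitions k. 1 / real (kostka_sum k la))"
      by (subst C) (simp_all add: KS)
    then show ?thesis
      unfolding volS enn2real_mult[symmetric] by (simp add: prod_nonneg)
  qed
  \<comment> \<open>The equation for \<open>M_slice\<close> yields this without evaluating the
    integral; it also rules out \<open>C\<close> infinite, where \<open>enn2real\<close> would be
    0.\<close>
  moreover have "enn2real C \<noteq> 0"
    using calculation(1) by auto
  ultimately show ?thesis
    by (metis mult_divide_mult_cancel_left div_by_1)
qed

end
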